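(* The irreducible weight matrices $W_H$, $W_L$ and $W_J$ are not Darboux transformations of any direct sum of scalar weights $w_1\oplus\cdots\oplus w_N$.
   Context: Weight matrices are smooth, a.e. positive definite matrix functions on an interval with finite moments; $\langle P,Q\rangle_W=\int PWQ^*dx$; $(P_n)$ the monic orthogonal polynomials. Differential operators act on the right: $P\cdot\sum_j\partial^jF_j=\sum_j\partial^j(P)F_j$. The right Fourier algebra $\mathcal F_R(W)$ is the set of differential operators $\mathfrak D$ with matrix polynomial coefficients for which there exist finitely many sequences of constant matrices $A_j(n)$, $-\ell\le j\le k$, with $P_n\cdot\mathfrak D=\sum_{j=-\ell}^kA_j(n)P_{n+j}$ for all $n$. Given weights $W_1,W_2$ with monic orthogonal polynomials $P_n,Q_n$, $W_2$ is a Darboux transformation of $W_1$ if there exist $\mathfrak D,\widetilde{\mathfrak D}\in\mathcal F_R(W_1)$, matrix polynomials $F,\widetilde F$ invertible as rational matrix functions, and sequences of constant matrices $C_n,\widetilde C_n$ nonsingular for almost every $n$ with $C_nQ_n=P_n\cdot\mathfrak DF^{-1}$ and $\widetilde C_nP_n=Q_n\cdot\widetilde F^{-1}\widetilde{\mathfrak D}$. Classical scalar weights: Hermite $w_b(x)=e^{-x^2+2bx}$ on $\mathbb R$; Laguerre $w_\alpha(x)=e^{-x}x^\alpha$ on $(0,\infty)$, $\alpha>-1$; Jacobi $w_{\alpha,\beta}(x)=(1-x)^\alpha(1+x)^\beta$ on $(-1,1)$, $\alpha,\beta>-1$. Let $N\ge2$, $A=\sum_{j=1}^{\lfloor N/2\rfloor}a_{2j-1}E_{2j-1,2j}+\sum_{j=1}^{\lfloor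 (N-1)/2\rfloor}a_{2j}E_{2j+1,2j}$ ($E_{s,t}$ matrix units, all $a_j\in\mathbb R\setminus\{0\}$), $T(x)=I+Ax$. $W_H=T\,\mathrm{diag}(w_{b_1},\dots,w_{b_N})\,T^*$ with $b_i$ pairwise distinct reals; $W_L=T\,\mathrm{diag}(w_{\alpha_1},\dots,w_{\alpha_N})\,T^*$ with $\alpha_i-\alpha_j\notin\mathbb Z$ for $i\ne j$; $W_J=T\,\mathrm{diag}(w_{\alpha_1,\beta_1},\dots,w_{\alpha_N,\beta_N})\,T^*$ with, for $i\ne j$, $\alpha_i-\alpha_j\notin\mathbb Z$ or $\beta_i-\beta_j\notin\mathbb Z$, and $\alpha_1+\beta_1=\alpha_j+\beta_j+1+(-1)^j$ for all $j$. *)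

theory Defs
  imports "HOL-Analysis.Analysis" "Jordan_Normal_Form.Determinant"
    "HOL-Computational_Algebra.Polynomial"
begin

(* Matrix conventions: Jordan_Normal_Form matrices, 0-based indices.
   A matrix polynomial of size N is an N x N matrix with entries in complex poly. *)

definition peval :: "complex poly mat \<Rightarrow> complex \<Rightarrow> complex mat" where
  "peval P z = map_mat (\<lambda>p. poly p z) P"

definition mcoeff :: "complex poly mat \<Rightarrow> nat \<Rightarrow> complex mat" where
  "mcoeff P k = map_mat (\<lambda>p. coeff p k) P"

definition constmat :: "complex mat \<Rightarrow> complex poly mat" where
  "constmat M = map_mat (\<lambda>c. [:c:]) M"

definition mpderiv :: "complex poly mat \<Rightarrow> complex poly mat" where
  "mpderiv P = map_mat pderiv P"

definition minv :: "complex mat \<Rightarrow> complex mat" where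
  "minv M = (1 / Determinant.det M) \<cdot>\<^sub>m adj_mat M"

definition cadj :: "nat \<Rightarrow> complex mat \<Rightarrow> complex mat" where
  "cadj N M = mat N N (\<lambda>(i,j). cnj (M $$ (j,i)))"

(* differential operator  D = sum_j d^j F_j  with matrix polynomial coefficients,
   represented by the list [F_0, F_1, ..., F_m]; acting on the right:
   P . D = sum_j (d^j P) F_j *)
definition op_apply :: "nat \<Rightarrow> complex poly mat \<Rightarrow> complex poly mat list \<Rightarrow> complex poly mat" where
  "op_apply N P D = mat N N (\<lambda>(r,c). \<Sum>j<length D. ((mpderiv ^^ j) P * D ! j) $$ (r,c))"

definition mderiv :: "nat \<Rightarrow> nat \<Rightarrow> (complex \<Rightarrow> complex mat) \<Rightarrow> complex \<Rightarrow> complex mat" where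
  "mderiv N j M z = mat N N (\<lambda>(r,c). (deriv ^^ j) (\<lambda>w. M w $$ (r,c)) z)"

definition fun_op_apply :: "nat \<Rightarrow> (complex \<Rightarrow> complex mat) \<Rightarrow> complex poly mat list \<Rightarrow> complex \<Rightarrow> complex mat" where
  "fun_op_apply N M D z = mat N N (\<lambda>(r,c). \<Sum>j<length D. (mderiv N j M z * peval (D ! j) z) $$ (r,c))"

definition monic_deg :: "nat \<Rightarrow> complex poly mat \<Rightarrow> nat \<Rightarrow> bool" where
  "monic_deg N P n \<longleftrightarrow> P \<in> carrier_mat N N \<and> mcoeff P n = 1\<^sub>m N \<and> (\<forall>k>n. mcoeff P k = 0\<^sub>m N N)"

definition ip :: "nat \<Rightarrow> real set \<Rightarrow> (real \<Rightarrow> real mat) \<Rightarrow> complex poly mat \<Rightarrow> complex poly mat \<Rightarrow> complex mat" where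
  "ip N S W P Q = mat N N (\<lambda>(r,c). LINT x:S|lborel.
      (peval P (complex_of_real x) * map_mat complex_of_real (W x)
        * cadj N (peval Q (complex_of_real x))) $$ (r,c))"

definition monic_OPs :: "nat \<Rightarrow> real set \<Rightarrow> (real \<Rightarrow> real mat) \<Rightarrow> (nat \<Rightarrow> complex poly mat) \<Rightarrow> bool" where
  "monic_OPs N S W P \<longleftrightarrow> (\<forall>n. monic_deg N (P n) n) \<and>
     (\<forall>n m. n \<noteq> m \<longrightarrow> ip N S W (P n) (P m) = 0\<^sub>m N N)"

(* D belongs to the right Fourier algebra F_R(W), where P is the sequence of monic OPs of W *)
definition fourier_R :: "nat \<Rightarrow> (nat \<Rightarrow> complex poly mat) \<Rightarrow> complex poly mat list \<Rightarrow> bool" where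
  "fourier_R N P D \<longleftrightarrow> (\<forall>F\<in>set D. F \<in> carrier_mat N N) \<and>
     (\<exists>(l::nat) (k::nat) (A::int \<Rightarrow> nat \<Rightarrow> complex mat).
        (\<forall>j n. A j n \<in> carrier_mat N N) \<and>
        (\<forall>n. op_apply N (P n) D = mat N N (\<lambda>(r,c).
            \<Sum>j\<in>{-int l..int k}. if int n + j < 0 then 0
               else (constmat (A j n) * P (nat (int n + j))) $$ (r,c))))"

definition darboux :: "nat \<Rightarrow> real set \<Rightarrow> (real \<Rightarrow> real mat) \<Rightarrow> real set \<Rightarrow> (real \<Rightarrow> real mat) \<Rightarrow> bool" where
  "darboux N S1 W1 S2 W2 \<longleftrightarrow> (\<exists>P Q. monic_OPs N S1 W1 P \<and> monic_OPs N S2 W2 Q \<and>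
     (\<exists>D Dt F Ft C Ct.
        fourier_R N P D \<and> fourier_R N P Dt \<and>
        F \<in> carrier_mat N N \<and> Ft \<in> carrier_mat N N \<and>
        Determinant.det F \<noteq> 0 \<and> Determinant.det Ft \<noteq> 0 \<and>
        (\<forall>n. C n \<in> carrier_mat N N \<and> Ct n \<in> carrier_mat N N) \<and>
        finite {n. Determinant.det (C n) = 0} \<and> finite {n. Determinant.det (Ct n) = 0} \<and>
        (\<forall>n z. Determinant.det (peval F z) \<noteq> 0 \<longrightarrow>
            C n * peval (Q n) z = peval (op_apply N (P n) D) z * minv (peval F z)) \<and>
        (\<forall>n z. Determinant.det (peval Ft z) \<noteq> 0 \<longrightarrow>
            Ct n * peval (P n) z = fun_op_apply N (\<lambda>w. peval (Q n) w * minv (peval Ft w)) Dt z)))"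

definition smooth_on :: "real set \<Rightarrow> (real \<Rightarrow> real) \<Rightarrow> bool" where
  "smooth_on S f \<longleftrightarrow> (\<forall>k. \<forall>x\<in>S. ((deriv ^^ k) f) differentiable (at x))"

definition scalar_weight :: "real set \<Rightarrow> (real \<Rightarrow> real) \<Rightarrow> bool" where
  "scalar_weight S w \<longleftrightarrow> is_interval S \<and> open S \<and> S \<noteq> {} \<and> smooth_on S w \<and>
     (AE x in lborel. x \<in> S \<longrightarrow> w x > 0) \<and>
     (\<forall>k::nat. set_integrable lborel S (\<lambda>x. x ^ k * w x))"

(* w_1 (+) ... (+) w_N ; the scalar weights are indexed 0..N-1 *)
definition direct_sum :: "nat \<Rightarrow> (nat \<Rightarrow> real \<Rightarrow> real) \<Rightarrow> real \<Rightarrow> real mat" where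
  "direct_sum N w x = mat N N (\<lambda>(i,j). if i = j then w i x else 0)"

definition darboux_of_direct_sum :: "nat \<Rightarrow> real set \<Rightarrow> (real \<Rightarrow> real mat) \<Rightarrow> bool" where
  "darboux_of_direct_sum N S W \<longleftrightarrow>
     (\<exists>S' w. (\<forall>i<N. scalar_weight S' (w i)) \<and> darboux N S' (direct_sum N w) S W)"

(* A = sum a_{2j-1} E_{2j-1,2j} + sum a_{2j} E_{2j+1,2j}  (paper's 1-based indices;
   a is indexed 1..N-1 as in the paper; matrix entries are 0-based) *)
definition matA :: "nat \<Rightarrow> (nat \<Rightarrow> real) \<Rightarrow> real mat" where
  "matA N a = mat N N (\<lambda>(r,c). if c = r + 1 \<and> even r then a (r + 1)
                               else if r = c + 1 \<and> odd c then a (c + 1) else 0)"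

definition matT :: "nat \<Rightarrow> (nat \<Rightarrow> real) \<Rightarrow> real \<Rightarrow> real mat" where
  "matT N a x = 1\<^sub>m N + x \<cdot>\<^sub>m matA N a"

(* T(x) diag(w_1(x),...,w_N(x)) T(x)^*, with w indexed 1..N *)
definition conj_diag :: "nat \<Rightarrow> (nat \<Rightarrow> real) \<Rightarrow> (nat \<Rightarrow> real \<Rightarrow> real) \<Rightarrow> real \<Rightarrow> real mat" where
  "conj_diag N a w x = matT N a x * mat N N (\<lambda>(i,j). if i = j then w (i + 1) x else 0)
                         * transpose_mat (matT N a x)"

definition hermite_w :: "real \<Rightarrow> real \<Rightarrow> real" where
  "hermite_w b x = exp (- x\<^sup>2 + 2 * b * x)"

definition laguerre_w :: "real \<Rightarrow> real \<Rightarrow> real" where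
  "laguerre_w \<alpha> x = exp (- x) * x powr \<alpha>"

definition jacobi_w :: "real \<Rightarrow> real \<Rightarrow> real \<Rightarrow> real" where
  "jacobi_w \<alpha> \<beta> x = (1 - x) powr \<alpha> * (1 + x) powr \<beta>"

definition W_H :: "nat \<Rightarrow> (nat \<Rightarrow> real) \<Rightarrow> (nat \<Rightarrow> real) \<Rightarrow> real \<Rightarrow> real mat" where
  "W_H N a b = conj_diag N a (\<lambda>i. hermite_w (b i))"

definition W_L :: "nat \<Rightarrow> (nat \<Rightarrow> real) \<Rightarrow> (nat \<Rightarrow> real) \<Rightarrow> real \<Rightarrow> real mat" where
  "W_L N a \<alpha> = conj_diag N a (\<lambda>i. laguerre_w (\<alpha> i))"

definition W_J :: "nat \<Rightarrow> (nat \<Rightarrow> real) \<Rightarrow> (nat \<Rightarrow> real) \<Rightarrow> (nat \<Rightarrow> real) \<Rightarrow> real \<Rightarrow> real mat" where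
  "W_J N a \<alpha> \<beta> = conj_diag N a (\<lambda>i. jacobi_w (\<alpha> i) (\<beta> i))"

end

theory Submission
  imports Defs "HOL-Probability.Distributions" "HOL-Real_Asymp.Real_Asymp"
begin

text \<open>Let \<open>W = T diag(w\<^sub>s) T\<^sup>*\<close> be one of the weights, with orthogonal polynomials \<open>Q\<^sub>n\<close>, and suppose it is a
  Darboux transformation of a direct sum. The orthogonal polynomials \<open>P\<^sub>n\<close> of the direct sum are diagonal,
  hence commute with the diagonal matrix units, and inserting the \<open>i\<close>-th unit between the two
  Darboux operators gives an operator \<open>X\<close> with \<open>Q\<^sub>n \<cdot> X = \<Lambda>\<^sub>n Q\<^sub>n\<close>, where \<open>\<Lambda>\<^sub>n = Ct\<^sub>n E\<^sub>i\<^sub>i C\<^sub>n\<close> has rank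
  at most one. An off-diagonal entry of \<open>T\<^sup>-\<^sup>1 X T\<close> has an adjoint relating \<open>w\<^sub>i\<close> and \<open>w\<^sub>j\<close>; commuting it
  with \<open>x\<close> until only its leading coefficient \<open>u\<close> is left gives \<open>u w\<^sub>j = v w\<^sub>i\<close> as moment functionals,
  which the Pearson equations exclude unless \<open>u = 0\<close>. So \<open>T\<^sup>-\<^sup>1 X T\<close> is diagonal. Since \<open>T = I + A x\<close>
  and \<open>X\<close> does not raise degrees, its first two diagonal entries have the same leading
  coefficients up to a shift of \<open>n\<close>; these are polynomial in \<open>n\<close>, and the rank condition makes
  them vanish. Hence the second row of every \<open>Ct\<^sub>n E\<^sub>i\<^sub>i C\<^sub>n\<close> is zero, which contradicts the generic
  invertibility of \<open>C\<^sub>n\<close> and \<open>Ct\<^sub>n\<close>.\<close>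

hide_const (open) Module.smult

section \<open>Linear operators of finite order on polynomials\<close>

text \<open>Weights enter only as moment functionals and operators only as linear maps on
  polynomials. Adjoints come from Riesz representation on finite-dimensional spaces, not from
  integrating the operators by parts: since
  \<open>Q\<^sub>n \<cdot> X = \<Lambda>\<^sub>n Q\<^sub>n\<close>, the operator respects the
  orthogonal decomposition by degree, so high components never reach a test polynomial of low
  degree. The obstacle is that the inverses of \<open>F\<close> and \<open>Ft\<close> are rational.
  They are cleared because the orthogonal polynomials span: a numerator divisible by the determinant
  on them is divisible on every polynomial. Two diagonal entries suffice because row 1 of A, counted
  from 0, is zero while its entry (0,1) is not. Row 1 of X then shows a single diagonal entry, and a
  degree count in the entry (0,1) links it to the diagonal entry 0.\<close>

definition deg_below :: "nat \<Rightarrow> 'a::zero poly \<Rightarrow> bool" where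
  "deg_below K p \<longleftrightarrow> (\<forall>n\<ge>K. coeff p n = 0)"

lemma deg_below_0 [simp]: "deg_below K 0"
  by (simp add: deg_below_def)

lemma deg_below_add: "deg_below K p \<Longrightarrow> deg_below K q \<Longrightarrow> deg_below K (p + q)"
  for p q :: "'a::comm_ring_1 poly"
  by (simp add: deg_below_def)

lemma deg_below_smult: "deg_below K p \<Longrightarrow> deg_below K (smult c p)"
  for p :: "'a::comm_ring_1 poly"
  by (simp add: deg_below_def)

lemma deg_below_sum: "(\<And>i. i \<in> I \<Longrightarrow> deg_below K (f i)) \<Longrightarrow> deg_below K (\<Sum>i\<in>I. f i)"
  for f :: "'b \<Rightarrow> 'a::comm_ring_1 poly"
  by (simp add: deg_below_def coeff_sum)

lemma deg_below_mono: "deg_below K p \<Longrightarrow> K \<le> M \<Longrightarrow> deg_below M p"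
  by (simp add: deg_below_def)

lemma deg_below_Suc_degree: "deg_below (Suc (degree p)) p"
  by (simp add: deg_below_def coeff_eq_0)

text \<open>The factor \<open>t\<close> will be an entry of \<open>T\<close> or of its inverse; this
  loss of one degree fixes the cut-offs in the construction of adjoints.\<close>

lemma deg_below_mult_linear:
  fixes p t :: "'a::comm_ring_1 poly"
  assumes "deg_below K p" "deg_below 2 t"
  shows "deg_below (Suc K) (p * t)"
  unfolding deg_below_def
proof (intro allI impI)
  fix n assume n: "Suc K \<le> n"
  have "coeff p i * coeff t (n - i) = 0" if "i \<le> n" for i
  proof (cases "i < K")
    case True
    then have "2 \<le> n - i" using n by simp
    then show ?thesis using assms(2) by (simp add: deg_below_def)
  next
    case False
    then show ?thesis using assms(1) by (simp add: deg_below_def)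
  qed
  then show "coeff (p * t) n = 0"
    by (simp add: coeff_mult)
qed

lemma deg_below_cnj: "deg_below K p \<Longrightarrow> deg_below K (map_poly cnj p)"
  by (simp add: deg_below_def coeff_map_poly)

lemma map_poly_cnj_add: "map_poly cnj (p + q) = map_poly cnj p + map_poly cnj q"
  by (simp add: poly_eq_iff coeff_map_poly)

lemma map_poly_cnj_mult: "map_poly cnj (p * q) = map_poly cnj p * map_poly cnj q"
  by (simp add: poly_eq_iff coeff_map_poly coeff_mult)

lemma map_poly_cnj_smult: "map_poly cnj (smult c p) = smult (cnj c) (map_poly cnj p)"
  by (simp add: poly_eq_iff coeff_map_poly)

lemma map_poly_cnj_sum: "map_poly cnj (\<Sum>i\<in>I. f i) = (\<Sum>i\<in>I. map_poly cnj (f i))"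
  by (simp add: poly_eq_iff coeff_map_poly coeff_sum)

lemma map_poly_cnj_cnj [simp]: "map_poly cnj (map_poly cnj p) = p"
  by (simp add: poly_eq_iff coeff_map_poly)

definition linear_op :: "(complex poly \<Rightarrow> complex poly) \<Rightarrow> bool" where
  "linear_op B \<longleftrightarrow> (\<forall>p q. B (p + q) = B p + B q) \<and> (\<forall>c p. B (smult c p) = smult c (B p))"

definition x_comm :: "(complex poly \<Rightarrow> complex poly) \<Rightarrow> complex poly \<Rightarrow> complex poly" where
  "x_comm B p = B ([:0,1:] * p) - [:0,1:] * B p"

text \<open>A linear operator on polynomials has order below \<open>k\<close> iff it is killed by \<open>k\<close> commutators
  with multiplication by \<open>x\<close>; this replaces working with coefficients of differential operators.\<close>

definition order_below :: "nat \<Rightarrow> (complex poly \<Rightarrow> complex poly) \<Rightarrow> bool" where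
  "order_below k B \<longleftrightarrow> linear_op B \<and> (x_comm ^^ k) B = (\<lambda>_. 0)"

lemma linear_opD:
  assumes "linear_op B"
  shows "B (p + q) = B p + B q" "B (smult c p) = smult c (B p)" "B 0 = 0"
    "B (p - q) = B p - B q" "B (\<Sum>i\<in>I. f i) = (\<Sum>i\<in>I. B (f i))"
proof -
  show add: "B (p + q) = B p + B q" for p q using assms by (simp add: linear_op_def)
  show smult: "B (smult c p) = smult c (B p)" for c p using assms by (simp add: linear_op_def)
  show zero: "B 0 = 0" using smult[of 0 0] by simp
  have "B (p - q) = B p + B (smult (-1) q)"
    unfolding add[symmetric] by simp
  then show "B (p - q) = B p - B q" unfolding smult by simp
  show "B (\<Sum>i\<in>I. f i) = (\<Sum>i\<in>I. B (f i))"
    by (induction I rule: infinite_finite_induct) (simp_all add: zero add)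
qed

lemma linear_op_x_comm:
  assumes "linear_op B"
  shows "linear_op (x_comm B)"
  using linear_opD[OF assms]
  by (simp add: linear_op_def x_comm_def distrib_left mult_smult_right smult_diff_right
      del: mult_pCons_left)

lemma linear_op_comp: "linear_op B \<Longrightarrow> linear_op C \<Longrightarrow> linear_op (\<lambda>p. B (C p))"
  by (simp add: linear_op_def)

lemma linear_op_add: "linear_op B \<Longrightarrow> linear_op C \<Longrightarrow> linear_op (\<lambda>p. B p + C p)"
  by (simp add: linear_op_def algebra_simps smult_add_right)

lemma order_below_linear: "order_below k B \<Longrightarrow> linear_op B"
  by (simp add: order_below_def)

lemma order_below_0_iff: "order_below 0 B \<longleftrightarrow> B = (\<lambda>_. 0)"
  by (auto simp: order_below_def linear_op_def)

lemma order_below_Suc_iff: "order_below (Suc k) B \<longleftrightarrow> linear_op B \<and> order_below k (x_comm B)"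
  by (auto simp: order_below_def funpow_Suc_right linear_op_x_comm simp del: funpow.simps)

lemma order_below_zero [simp]: "order_below k (\<lambda>_. 0)"
proof (induction k)
  case (Suc k)
  have "x_comm (\<lambda>_. 0) = (\<lambda>_. 0)" by (simp add: x_comm_def fun_eq_iff)
  with Suc show ?case by (simp add: order_below_Suc_iff linear_op_def)
qed (simp add: order_below_0_iff)

lemma order_below_mono: "order_below k B \<Longrightarrow> k \<le> l \<Longrightarrow> order_below l B"
proof (induction k arbitrary: B l)
  case 0
  then show ?case by (simp add: order_below_0_iff)
next
  case (Suc k)
  then obtain l' where "l = Suc l'" "k \<le> l'" by (metis Suc_le_D Suc_le_mono)
  then show ?case using Suc by (simp add: order_below_Suc_iff)
qed

lemma order_below_add_same:
  "order_below k B \<Longrightarrow> order_below k C \<Longrightarrow> order_below k (\<lambda>p. B p + C p)"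
proof (induction k arbitrary: B C)
  case 0
  then show ?case by (simp add: order_below_0_iff)
next
  case (Suc k)
  have "x_comm (\<lambda>p. B p + C p) = (\<lambda>p. x_comm B p + x_comm C p)"
    by (simp add: x_comm_def fun_eq_iff algebra_simps)
  then show ?case using Suc by (simp add: order_below_Suc_iff linear_op_add)
qed

text \<open>Commutation with x is a derivation, [BC,x] = B[C,x] + [B,x]C, and each summand lowers
  one of the two orders; hence induction on their sum.\<close>

lemma order_below_comp:
  assumes "order_below k B" "order_below l C"
  shows "order_below (k + l) (\<lambda>p. B (C p))"
  using assms
proof (induction "k + l" arbitrary: k l B C)
  case 0
  then show ?case by (simp add: order_below_0_iff)
next
  case (Suc n)
  note B = linear_opD[OF order_below_linear[OF Suc.prems(1)]]
  note lin = order_below_linear[OF Suc.prems(1)] order_below_linear[OF Suc.prems(2)]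
  consider "k = 0" | "l = 0" | k' l' where "k = Suc k'" "l = Suc l'"
    by (metis not0_implies_Suc)
  then show ?case
  proof cases
    case 1
    then show ?thesis using Suc.prems by (simp add: order_below_0_iff)
  next
    case 2
    then have "(\<lambda>p. B (C p)) = (\<lambda>_. 0)" using Suc.prems B by (simp add: order_below_0_iff)
    then show ?thesis by simp
  next
    case 3
    have eq: "x_comm (\<lambda>p. B (C p)) = (\<lambda>p. B (x_comm C p) + x_comm B (C p))"
      by (simp only: x_comm_def fun_eq_iff B) simp
    have "order_below (k + l') (\<lambda>p. B (x_comm C p))"
      using Suc.hyps(1)[of k l' B "x_comm C"] Suc.hyps(2) Suc.prems 3
      by (simp add: order_below_Suc_iff)
    moreover have "order_below (k' + l) (\<lambda>p. x_comm B (C p))"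
      using Suc.hyps(1)[of k' l "x_comm B" C] Suc.hyps(2) Suc.prems 3
      by (simp add: order_below_Suc_iff)
    ultimately have "order_below (k + l') (x_comm (\<lambda>p. B (C p)))"
      unfolding eq using 3 by (intro order_below_add_same) simp_all
    then show ?thesis using 3 lin by (simp add: order_below_Suc_iff linear_op_comp)
  qed
qed

definition finite_order :: "(complex poly \<Rightarrow> complex poly) \<Rightarrow> bool" where
  "finite_order B \<longleftrightarrow> (\<exists>k. order_below k B)"

lemma finite_order_linear: "finite_order B \<Longrightarrow> linear_op B"
  by (auto simp: finite_order_def order_below_linear)

lemma finite_order_zero: "finite_order (\<lambda>_. 0)"
  using order_below_zero by (auto simp: finite_order_def)

lemma finite_order_add: "finite_order B \<Longrightarrow> finite_order C \<Longrightarrow> finite_order (\<lambda>p. B p + C p)"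
  unfolding finite_order_def
  by (metis order_below_add_same order_below_mono nat_le_linear)

lemma finite_order_comp: "finite_order B \<Longrightarrow> finite_order C \<Longrightarrow> finite_order (\<lambda>p. B (C p))"
  unfolding finite_order_def using order_below_comp by blast

lemma finite_order_sum:
  "(\<And>i. i \<in> I \<Longrightarrow> finite_order (B i)) \<Longrightarrow> finite_order (\<lambda>p. \<Sum>i\<in>I. B i p)"
  by (induction I rule: infinite_finite_induct) (simp_all add: finite_order_zero finite_order_add)

lemma finite_order_id: "finite_order (\<lambda>p. p)"
proof -
  have "x_comm (\<lambda>p. p) = (\<lambda>_. 0)" by (simp add: x_comm_def fun_eq_iff)
  then have "order_below (Suc 0) (\<lambda>p. p)"
    by (simp add: order_below_Suc_iff order_below_0_iff linear_op_def)
  then show ?thesis by (auto simp: finite_order_def)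
qed

lemma finite_order_mult: "finite_order B \<Longrightarrow> finite_order (\<lambda>p. B p * t)"
proof -
  have "x_comm (\<lambda>p. p * t) = (\<lambda>_. 0)" by (simp add: x_comm_def fun_eq_iff)
  then have "order_below (Suc 0) (\<lambda>p. p * t)"
    by (simp add: order_below_Suc_iff order_below_0_iff linear_op_def algebra_simps)
  then show "finite_order B \<Longrightarrow> finite_order (\<lambda>p. B p * t)"
    using finite_order_comp[of "\<lambda>p. p * t" B] by (auto simp: finite_order_def)
qed

lemma finite_order_minus: "finite_order B \<Longrightarrow> finite_order C \<Longrightarrow> finite_order (\<lambda>p. B p - C p)"
  using finite_order_add[of B "\<lambda>p. C p * [:-1:]"] finite_order_mult[of C "[:-1:]"] by simp

lemma finite_order_pderiv: "finite_order B \<Longrightarrow> finite_order (\<lambda>p. pderiv (B p))"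
proof -
  have "x_comm pderiv = (\<lambda>p. p)"
    by (simp add: x_comm_def fun_eq_iff pderiv_mult pderiv_pCons)
  moreover have "linear_op pderiv" by (simp add: linear_op_def pderiv_add pderiv_smult)
  ultimately have "finite_order pderiv"
    using finite_order_id order_below_Suc_iff unfolding finite_order_def by metis
  then show "finite_order B \<Longrightarrow> finite_order (\<lambda>p. pderiv (B p))"
    by (rule finite_order_comp)
qed

lemma finite_order_funpow_pderiv: "finite_order (\<lambda>p. (pderiv ^^ j) p)"
  by (induction j) (simp_all add: finite_order_id finite_order_pderiv)

text \<open>Multiplication by \<open>d\<close> commutes with x and is injective, so a commutator of
  \<open>B\<close> vanishes as soon as that of \<open>d * B\<close> does. It serves operators
  defined by exact division by a determinant.\<close>

lemma finite_order_cancel: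
  assumes "finite_order (\<lambda>p. d * B p)" "d \<noteq> 0"
  shows "finite_order B"
proof -
  obtain k where "order_below k (\<lambda>p. d * B p)" using assms by (auto simp: finite_order_def)
  then have "order_below k B"
  proof (induction k arbitrary: B)
    case 0
    then show ?case using assms(2) by (auto simp: order_below_0_iff fun_eq_iff)
  next
    case (Suc k)
    have "linear_op (\<lambda>p. d * B p)" using Suc.prems by (simp add: order_below_Suc_iff)
    then have "\<forall>p q. d * B (p + q) = d * (B p + B q)"
      and "\<forall>c p. d * B (smult c p) = d * smult c (B p)"
      by (auto simp: linear_op_def algebra_simps)
    then have "linear_op B" using assms(2) by (simp add: linear_op_def del: mult_smult_right)
    moreover have "x_comm (\<lambda>p. d * B p) = (\<lambda>p. d * x_comm B p)"
      by (simp add: x_comm_def fun_eq_iff algebra_simps)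
    ultimately show ?case using Suc by (simp add: order_below_Suc_iff)
  qed
  then show ?thesis by (auto simp: finite_order_def)
qed

section \<open>Finite differences of coefficient sequences\<close>

definition diff_seq :: "(nat \<Rightarrow> complex) \<Rightarrow> nat \<Rightarrow> complex" where
  "diff_seq f n = f (Suc n) - f n"

text \<open>Newton's forward difference formula. The induction on \<open>n\<close> varies
  \<open>f\<close>, since the step applies it to both \<open>f\<close> and
  \<open>diff_seq f\<close>.\<close>

lemma newton_forward:
  assumes "(diff_seq ^^ k) f = (\<lambda>_. 0)"
  shows "f n = (\<Sum>i<k. of_nat (n choose i) * (diff_seq ^^ i) f 0)"
  using assms
proof (induction n arbitrary: f)
  case 0
  show ?case
  proof (cases k)
    case 0
    then show ?thesis using "0.prems" by simp
  next
    case (Suc k')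
    show ?thesis unfolding Suc by (subst sum.lessThan_Suc_shift) (simp add: binomial_eq_0)
  qed
next
  case (Suc n)
  let ?g = "\<lambda>i. (diff_seq ^^ i) f 0"
  have "diff_seq (\<lambda>_. 0) = (\<lambda>_. 0)" by (simp add: diff_seq_def fun_eq_iff)
  then have "(diff_seq ^^ k) (diff_seq f) = (\<lambda>_. 0)"
    using Suc.prems by (metis funpow_swap1)
  then have "diff_seq f n = (\<Sum>i<k. of_nat (n choose i) * (diff_seq ^^ i) (diff_seq f) 0)"
    by (rule Suc.IH)
  then have 1: "diff_seq f n = (\<Sum>i<k. of_nat (n choose i) * ?g (Suc i))"
    by (simp add: funpow_Suc_right del: funpow.simps)
  have gk: "?g k = 0" using Suc.prems by simp
  have "(\<Sum>i<k. of_nat (Suc n choose i) * ?g i)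
      = (\<Sum>i<k. of_nat (n choose i) * ?g i) + (\<Sum>i<k. of_nat (n choose i) * ?g (Suc i))"
  proof (cases k)
    case 0
    then show ?thesis by simp
  next
    case (Suc k')
    have "(\<Sum>i<k. of_nat (n choose i) * ?g (Suc i)) = (\<Sum>i<k'. of_nat (n choose i) * ?g (Suc i))"
      using gk Suc by simp
    moreover have "(\<Sum>i<k. of_nat (Suc n choose i) * ?g i)
      = ?g 0 + (\<Sum>i<k'. of_nat (Suc n choose Suc i) * ?g (Suc i))"
      unfolding Suc by (subst sum.lessThan_Suc_shift) simp
    moreover have "(\<Sum>i<k. of_nat (n choose i) * ?g i)
      = ?g 0 + (\<Sum>i<k'. of_nat (n choose Suc i) * ?g (Suc i))"
      unfolding Suc by (subst sum.lessThan_Suc_shift) simp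
    ultimately show ?thesis by (simp add: sum.distrib algebra_simps del: funpow.simps)
  qed
  then have "(\<Sum>i<k. of_nat (Suc n choose i) * ?g i) = f n + diff_seq f n"
    using 1 Suc.IH[OF Suc.prems] by (simp only:)
  moreover have "f (Suc n) = f n + diff_seq f n" by (simp add: diff_seq_def)
  ultimately show ?case by (simp only:)
qed

lemma poly_seq_of_diff_zero:
  assumes "(diff_seq ^^ k) f = (\<lambda>_. 0)"
  shows "\<exists>p. \<forall>n. f n = poly p (of_nat n)"
proof (intro exI allI)
  fix n
  \<comment> \<open>The product is the falling factorial, which makes the binomial coefficient a
    polynomial in n.\<close>
  have "poly (\<Prod>j<i. [:- of_nat j, 1:]) (of_nat n) = fact i * (of_nat (n choose i) :: complex)" for i
    by (simp add: poly_prod binomial_gbinomial gbinomial_prod_rev lessThan_atLeast0)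
  then show "f n = poly (\<Sum>i<k. smult ((diff_seq ^^ i) f 0 / fact i) (\<Prod>j<i. [:- of_nat j, 1:])) (of_nat n)"
    using newton_forward[OF assms, of n] by (simp add: poly_sum mult.commute)
qed

text \<open>Reading off a coefficient turns commutation with x into a forward difference: the one of
  \<open>x_comm B\<close> at \<open>n + Suc s\<close> is the increment from n to n + 1 of the one of
  \<open>B\<close>. The shift \<open>s\<close> is general because it grows at each step.\<close>

lemma order_below_diff_coeff:
  assumes "order_below k B"
  shows "(diff_seq ^^ k) (\<lambda>n. coeff (B (monom 1 n)) (n + s)) = (\<lambda>_. 0)"
  using assms
proof (induction k arbitrary: B s)
  case 0
  then show ?case by (simp add: order_below_0_iff)
next
  case (Suc k)
  have "diff_seq (\<lambda>n. coeff (B (monom 1 n)) (n + s)) = (\<lambda>n. coeff (x_comm B (monom 1 n)) (n + Suc s))"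
    by (simp add: diff_seq_def x_comm_def fun_eq_iff monom_Suc)
  then show ?case using Suc.prems Suc.IH[of "x_comm B" "Suc s"]
    by (simp add: order_below_Suc_iff funpow_Suc_right del: funpow.simps)
qed

text \<open>The diagonal coefficient is a polynomial in n; a nonzero one has finitely many zeros,
  and beyond them two consecutive values are nonzero.\<close>

lemma finite_order_consecutive_zeros:
  assumes "finite_order B" "\<And>n. coeff (B (monom 1 n)) n = 0 \<or> coeff (B (monom 1 (Suc n))) (Suc n) = 0"
  shows "coeff (B (monom 1 n)) n = 0"
proof -
  define f where "f = (\<lambda>n. coeff (B (monom 1 n)) (n + 0))"
  obtain k where "order_below k B" using assms(1) by (auto simp: finite_order_def)
  then have "(diff_seq ^^ k) f = (\<lambda>_. 0)" unfolding f_def by (rule order_below_diff_coeff)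
  then obtain p where p: "\<And>n. f n = poly p (of_nat n)" using poly_seq_of_diff_zero by blast
  have "p = 0"
  proof (rule ccontr)
    assume "p \<noteq> 0"
    then have "finite {z. poly p z = 0}" by (rule poly_roots_finite)
    then have fin: "finite {n. f n = 0}"
      unfolding p using finite_vimageI[of "{z. poly p z = 0}" "of_nat :: nat \<Rightarrow> complex"]
      by (simp add: vimage_def inj_on_def)
    then obtain m where "\<forall>n. f n = 0 \<longrightarrow> n \<le> m"
      by (auto simp: finite_nat_set_iff_bounded_le)
    moreover have "f (Suc m) = 0 \<or> f (Suc (Suc m)) = 0"
      using assms(2) by (simp add: f_def)
    ultimately show False by fastforce
  qed
  then show ?thesis using p[of n] by (simp add: f_def)
qed

section \<open>Positive functionals and orthogonal rows\<close>

definition linear_functional :: "(complex poly \<Rightarrow> complex) \<Rightarrow> bool" where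
  "linear_functional L \<longleftrightarrow> (\<forall>p q. L (p + q) = L p + L q) \<and> (\<forall>c p. L (smult c p) = c * L p)"

lemma linear_functionalD:
  assumes "linear_functional L"
  shows "L (p + q) = L p + L q" "L (smult c p) = c * L p" "L 0 = 0"
    "L (p - q) = L p - L q" "L (\<Sum>i\<in>I. f i) = (\<Sum>i\<in>I. L (f i))"
proof -
  show add: "L (p + q) = L p + L q" for p q using assms by (simp add: linear_functional_def)
  show smult: "L (smult c p) = c * L p" for c p using assms by (simp add: linear_functional_def)
  show zero: "L 0 = 0" using smult[of 0 0] by simp
  have "L (p - q) = L p + L (smult (-1) q)"
    unfolding add[symmetric] by simp
  then show "L (p - q) = L p - L q" unfolding smult by simp
  show "L (\<Sum>i\<in>I. f i) = (\<Sum>i\<in>I. L (f i))"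
    by (induction I rule: infinite_finite_induct) (simp_all add: zero add)
qed

lemma linear_functional_mult:
  "linear_functional L \<Longrightarrow> linear_functional (\<lambda>p. L (p * v))"
  by (simp add: linear_functional_def distrib_right)

text \<open>On the real line \<open>map_poly cnj p\<close> takes the values conjugate to those of
  \<open>p\<close>, so the product is |p|^2 there. Stating positivity for the real part spares a
  separate reality condition.\<close>

definition positive_functional :: "(complex poly \<Rightarrow> complex) \<Rightarrow> bool" where
  "positive_functional L \<longleftrightarrow> linear_functional L \<and>
     (\<forall>p. 0 \<le> Re (L (p * map_poly cnj p))) \<and>
     (\<forall>p. Re (L (p * map_poly cnj p)) = 0 \<longrightarrow> p = 0)"

lemma positive_functionalD:
  assumes "positive_functional L"
  shows "linear_functional L" "0 \<le> Re (L (p * map_poly cnj p))"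
    "Re (L (p * map_poly cnj p)) = 0 \<Longrightarrow> p = 0"
  using assms by (auto simp: positive_functional_def)

lemma deg_below_Suc_decomp:
  fixes p :: "complex poly"
  assumes "deg_below (Suc K) p"
  shows "deg_below K (p - smult (coeff p K) (monom 1 K))"
  using assms by (auto simp: deg_below_def)

text \<open>A Gram-Schmidt step: \<open>p0\<close> is the projection of x^K to lower degrees, so
  \<open>h\<close> is the next orthogonal polynomial. While \<open>v0\<close> represents the
  functional on lower degrees, a multiple of \<open>h\<close> corrects the value at x^K without
  disturbing them.\<close>

lemma riesz_below:
  assumes L: "positive_functional L" and \<phi>: "linear_functional \<phi>"
  shows "\<exists>v. deg_below K v \<and> (\<forall>p. deg_below K p \<longrightarrow> \<phi> p = L (p * v))"
  using \<phi>
proof (induction K arbitrary: \<phi>)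
  case 0
  have "p = 0" if "deg_below 0 p" for p :: "complex poly"
    using that by (simp add: deg_below_def poly_eq_iff)
  then show ?case
    using linear_functionalD(3)[OF 0] linear_functionalD(3)[OF positive_functionalD(1)[OF L]]
    by (intro exI[of _ 0]) auto
next
  case (Suc K)
  note lin = linear_functionalD[OF positive_functionalD(1)[OF L]]
  note lin\<phi> = linear_functionalD[OF Suc.prems]
  let ?x = "monom 1 K :: complex poly"
  obtain p0 where p0: "deg_below K p0" "\<And>p. deg_below K p \<Longrightarrow> L (p * ?x) = L (p * p0)"
    using Suc.IH[OF linear_functional_mult[OF positive_functionalD(1)[OF L]]] by blast
  obtain v0 where v0: "deg_below K v0" "\<And>p. deg_below K p \<Longrightarrow> \<phi> p = L (p * v0)"
    using Suc.IH[OF Suc.prems] by blast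
  define h where "h = ?x - p0"
  have h_orth: "L (p * h) = 0" if "deg_below K p" for p
    using p0(2)[OF that] by (simp add: h_def right_diff_distrib lin)
  have hK: "coeff h K = 1" using p0(1) by (simp add: h_def deg_below_def)
  have hd: "deg_below (Suc K) h" using p0(1) by (simp add: h_def deg_below_def)
  \<comment> \<open>The conjugate of \<open>h\<close> differs from x^K by terms of lower degree,
    which are orthogonal to \<open>h\<close>; a zero value would make the norm of \<open>h\<close>
    vanish.\<close>
  have "L (?x * h) \<noteq> 0"
  proof
    assume 0: "L (?x * h) = 0"
    have "deg_below K (map_poly cnj h - smult (coeff (map_poly cnj h) K) ?x)"
      using hd by (intro deg_below_Suc_decomp deg_below_cnj)
    then have "L ((map_poly cnj h - ?x) * h) = 0"
      using hK by (intro h_orth) (simp add: coeff_map_poly)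
    then have "L (h * map_poly cnj h) = 0"
      using 0 unfolding left_diff_distrib lin by (simp add: mult.commute)
    then have "h = 0" using positive_functionalD(3)[OF L, of h] by simp
    then show False using hK by simp
  qed
  define c where "c = (\<phi> ?x - L (?x * v0)) / L (?x * h)"
  have c: "\<phi> ?x = L (?x * v0) + c * L (?x * h)"
    using \<open>L (?x * h) \<noteq> 0\<close> by (simp add: c_def)
  show ?case
  proof (intro exI conjI allI impI)
    show "deg_below (Suc K) (v0 + smult c h)"
      using hd deg_below_mono[OF v0(1), of "Suc K"]
      by (intro deg_below_add deg_below_smult) simp_all
    fix p :: "complex poly" assume p: "deg_below (Suc K) p"
    define p' where "p' = p - smult (coeff p K) ?x"
    have p': "deg_below K p'" unfolding p'_def using p by (rule deg_below_Suc_decomp)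
    have pe: "p = p' + smult (coeff p K) ?x" by (simp add: p'_def)
    have "L (p * (v0 + smult c h))
        = L (p' * v0) + c * L (p' * h) + coeff p K * (L (?x * v0) + c * L (?x * h))"
      by (subst pe) (simp add: distrib_left distrib_right lin smult_add_right algebra_simps del: smult_smult)
    also have "\<dots> = \<phi> p' + coeff p K * \<phi> ?x"
      unfolding h_orth[OF p'] v0(2)[OF p', symmetric] c[symmetric] by simp
    also have "\<dots> = \<phi> p" using lin\<phi>(1,2) pe by metis
    finally show "\<phi> p = L (p * (v0 + smult c h))" by simp
  qed
qed

definition monic_family :: "nat \<Rightarrow> (nat \<Rightarrow> nat \<Rightarrow> nat \<Rightarrow> complex poly) \<Rightarrow> bool" where
  "monic_family N Q \<longleftrightarrow> (\<forall>n. \<forall>r<N. \<forall>c<N. deg_below (Suc n) (Q n r c) \<and>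
     coeff (Q n r c) n = (if r = c then 1 else 0))"

text \<open>The leading matrix of \<open>Q M\<close> is the identity, so subtracting its rows with
  the top coefficients of \<open>q\<close> as weights lowers the degree bound.\<close>

lemma monic_family_span:
  assumes Q: "monic_family N Q" and q: "\<forall>s<N. deg_below M (q s)"
  shows "\<exists>c. \<forall>s<N. q s = (\<Sum>n<M. \<Sum>k<N. smult (c n k) (Q n k s))"
  using q
proof (induction M arbitrary: q)
  case 0
  then show ?case by (simp add: deg_below_def poly_eq_iff)
next
  case (Suc M)
  define q' where "q' s = q s - (\<Sum>k<N. smult (coeff (q k) M) (Q M k s))" for s
  have "deg_below M (q' s)" if s: "s < N" for s
    unfolding deg_below_def
  proof (intro allI impI)
    fix n assume "M \<le> n"
    show "coeff (q' s) n = 0"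
    proof (cases "n = M")
      case True
      have "(\<Sum>k<N. coeff (q k) M * coeff (Q M k s) M) = (\<Sum>k<N. if k = s then coeff (q k) M else 0)"
        using Q s by (intro sum.cong) (auto simp: monic_family_def)
      then show ?thesis using True s by (simp add: q'_def coeff_sum)
    next
      case False
      then have "Suc M \<le> n" using \<open>M \<le> n\<close> by simp
      then have "coeff (Q M k s) n = 0" if "k < N" for k
        using Q s that by (auto simp: monic_family_def deg_below_def)
      then show ?thesis using Suc.prems s \<open>Suc M \<le> n\<close>
        by (simp add: q'_def coeff_sum deg_below_def)
    qed
  qed
  then obtain c where c: "\<forall>s<N. q' s = (\<Sum>n<M. \<Sum>k<N. smult (c n k) (Q n k s))"
    using Suc.IH by blast
  have "q s = (\<Sum>n<Suc M. \<Sum>k<N. smult ((c(M := \<lambda>k. coeff (q k) M)) n k) (Q n k s))" if "s < N" for s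
  proof -
    have "q s = q' s + (\<Sum>k<N. smult (coeff (q k) M) (Q M k s))" by (simp add: q'_def)
    then show ?thesis using c that by simp
  qed
  then show ?case by blast
qed

lemma smult_sum_right: "smult c (\<Sum>i\<in>I. f i) = (\<Sum>i\<in>I. smult c (f i))"
  by (induction I rule: infinite_finite_induct) (simp_all add: smult_add_right)

lemma ex_deg_below:
  fixes R :: "nat \<Rightarrow> 'a::zero poly"
  shows "\<exists>M. \<forall>s<N. deg_below M (R s)"
proof (intro exI allI impI)
  fix s assume "s < N"
  then have "Suc (degree (R s)) \<le> Suc (Max ((\<lambda>s. degree (R s)) ` {..<N}))" by (intro Suc_le_mono[THEN iffD2] Max_ge) auto
  then show "deg_below (Suc (Max ((\<lambda>s. degree (R s)) ` {..<N}))) (R s)"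
    using deg_below_mono deg_below_Suc_degree by blast
qed

lemma sum_delta_mult:
  fixes f :: "nat \<Rightarrow> 'a::comm_ring_1"
  assumes "i < N"
  shows "(\<Sum>s<N. f s * (if i = s then 1 else 0)) = f i"
    "(\<Sum>s<N. f s * (if s = i then 1 else 0)) = f i"
    "(\<Sum>s<N. (if i = s then 1 else 0) * f s) = f i"
  using assms by (simp_all add: if_distrib[of "\<lambda>x. _ * x"] if_distrib[of "\<lambda>x. x * _"] cong: if_cong)

text \<open>\<open>\<Sum>\<^sub>s L\<^sub>s ((p T)\<^sub>s (q T)\<^sub>s)\<close> is the bilinear version of the inner product of the weight
  \<open>T diag(w\<^sub>s) T\<^sup>*\<close>, \<open>L\<^sub>s\<close> being integration against \<open>w\<^sub>s\<close>; rows of matrix polynomials are functions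
  on \<open>{..<N}\<close>, and \<open>Q n k\<close> is row \<open>k\<close> of the \<open>n\<close>-th orthogonal polynomial.\<close>

locale orthogonal_rows =
  fixes N :: nat and L :: "nat \<Rightarrow> complex poly \<Rightarrow> complex"
    and T Ti :: "nat \<Rightarrow> nat \<Rightarrow> complex poly"
    and Q :: "nat \<Rightarrow> nat \<Rightarrow> nat \<Rightarrow> complex poly"
  assumes pos: "s < N \<Longrightarrow> positive_functional (L s)"
    and T_Ti: "r < N \<Longrightarrow> c < N \<Longrightarrow> (\<Sum>s<N. T r s * Ti s c) = (if r = c then 1 else 0)"
    and Ti_T: "r < N \<Longrightarrow> c < N \<Longrightarrow> (\<Sum>s<N. Ti r s * T s c) = (if r = c then 1 else 0)"
    and T_deg: "r < N \<Longrightarrow> c < N \<Longrightarrow> deg_below 2 (T r c)"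
    and Ti_deg: "r < N \<Longrightarrow> c < N \<Longrightarrow> deg_below 2 (Ti r c)"
    and T_real: "r < N \<Longrightarrow> c < N \<Longrightarrow> map_poly cnj (T r c) = T r c"
    and monic: "monic_family N Q"
    and orth: "n \<noteq> m \<Longrightarrow> k < N \<Longrightarrow> k' < N \<Longrightarrow>
      (\<Sum>s<N. L s ((\<Sum>r<N. Q n k r * T r s) * map_poly cnj (\<Sum>r<N. Q m k' r * T r s))) = 0"
begin

definition rowT :: "(nat \<Rightarrow> complex poly) \<Rightarrow> nat \<Rightarrow> complex poly" where
  "rowT p s = (\<Sum>r<N. p r * T r s)"

definition form :: "(nat \<Rightarrow> complex poly) \<Rightarrow> (nat \<Rightarrow> complex poly) \<Rightarrow> complex" where
  "form p q = (\<Sum>s<N. L s (rowT p s * rowT q s))"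

lemmas L_lin = linear_functionalD[OF positive_functionalD(1)[OF pos]]

lemma form_commute: "form p q = form q p"
  by (simp add: form_def mult.commute)

lemma form_cong:
  assumes "\<And>s. s < N \<Longrightarrow> p s = p' s"
  shows "form p q = form p' q"
proof -
  have "rowT p s = rowT p' s" for s unfolding rowT_def using assms by (intro sum.cong) auto
  then show ?thesis by (simp add: form_def)
qed

lemma form_sum: "form (\<lambda>s. \<Sum>i\<in>I. p i s) q = (\<Sum>i\<in>I. form (p i) q)"
proof -
  have "rowT (\<lambda>s. \<Sum>i\<in>I. p i s) s = (\<Sum>i\<in>I. rowT (p i) s)" for s
    unfolding rowT_def sum_distrib_right by (rule sum.swap)
  then have "form (\<lambda>s. \<Sum>i\<in>I. p i s) q = (\<Sum>s<N. \<Sum>i\<in>I. L s (rowT (p i) s * rowT q s))"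
    unfolding form_def by (intro sum.cong) (auto simp: sum_distrib_right L_lin)
  also have "\<dots> = (\<Sum>i\<in>I. form (p i) q)"
    unfolding form_def by (rule sum.swap)
  finally show ?thesis .
qed

lemma form_smult: "form (\<lambda>s. smult c (p s)) q = c * form p q"
proof -
  have "rowT (\<lambda>s. smult c (p s)) s = smult c (rowT p s)" for s
    unfolding rowT_def by (induction N) (simp_all add: smult_add_right)
  then show ?thesis by (simp add: form_def L_lin sum_distrib_left)
qed

lemma rowT_cnj: "s < N \<Longrightarrow> rowT (\<lambda>r. map_poly cnj (p r)) s = map_poly cnj (rowT p s)"
  by (simp add: rowT_def map_poly_cnj_sum map_poly_cnj_mult T_real)

lemma form_orth: "n \<noteq> m \<Longrightarrow> k < N \<Longrightarrow> k' < N \<Longrightarrow> form (Q n k) (\<lambda>r. map_poly cnj (Q m k' r)) = 0"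
  using orth[of n m k k'] by (simp add: form_def rowT_cnj) (simp add: rowT_def)

text \<open>Orthogonality pairs \<open>Q n\<close> with conjugates of rows \<open>Q m\<close>, so it
  is the conjugate of \<open>q\<close> that is expanded in rows of index below
  \<open>n\<close>.\<close>

lemma form_orth_below:
  assumes "k < N" "\<forall>s<N. deg_below n (q s)"
  shows "form (Q n k) q = 0"
proof -
  have "\<forall>s<N. deg_below n (map_poly cnj (q s))" using assms by (simp add: deg_below_cnj)
  then obtain c where c: "\<forall>s<N. map_poly cnj (q s) = (\<Sum>m<n. \<Sum>l<N. smult (c m l) (Q m l s))"
    using monic_family_span[OF monic, where q = "\<lambda>s. map_poly cnj (q s)"] by blast
  have "q s = (\<Sum>m<n. \<Sum>l<N. smult (cnj (c m l)) (map_poly cnj (Q m l s)))" if "s < N" for s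
  proof -
    have "q s = map_poly cnj (map_poly cnj (q s))" by simp
    also have "map_poly cnj (q s) = (\<Sum>m<n. \<Sum>l<N. smult (c m l) (Q m l s))" using c that by simp
    finally show ?thesis by (simp add: map_poly_cnj_sum map_poly_cnj_smult)
  qed
  then have "form q (Q n k)
      = form (\<lambda>s. \<Sum>m<n. \<Sum>l<N. smult (cnj (c m l)) (map_poly cnj (Q m l s))) (Q n k)"
    by (rule form_cong)
  also have "\<dots> = (\<Sum>m<n. \<Sum>l<N. cnj (c m l) * form (\<lambda>s. map_poly cnj (Q m l s)) (Q n k))"
    by (simp add: form_sum form_smult)
  also have "\<dots> = 0"
    using assms(1) by (simp add: form_commute[of _ "Q n k"] form_orth)
  finally show ?thesis by (simp add: form_commute)
qed

text \<open>The summands are nonnegative, hence all zero, and definiteness of each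
  \<open>L s\<close> kills \<open>rowT w\<close>; multiplying by \<open>Ti\<close> recovers
  \<open>w\<close>.\<close>

lemma form_cnj_self_0:
  assumes "form w (\<lambda>r. map_poly cnj (w r)) = 0" "s < N"
  shows "w s = 0"
proof -
  have "(\<Sum>s<N. Re (L s (rowT w s * map_poly cnj (rowT w s)))) = Re (form w (\<lambda>r. map_poly cnj (w r)))"
    by (simp add: form_def rowT_cnj)
  then have "(\<Sum>s<N. Re (L s (rowT w s * map_poly cnj (rowT w s)))) = 0" using assms by simp
  then have "\<forall>s\<in>{..<N}. Re (L s (rowT w s * map_poly cnj (rowT w s))) = 0"
    using positive_functionalD(2)[OF pos] by (subst (asm) sum_nonneg_eq_0_iff) auto
  then have rowT0: "rowT w t = 0" if "t < N" for t
    using positive_functionalD(3)[OF pos] that by blast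
  have "w s = (\<Sum>r<N. w r * (\<Sum>t<N. T r t * Ti t s))"
    using assms(2) by (simp add: T_Ti sum_delta_mult)
  also have "\<dots> = (\<Sum>t<N. rowT w t * Ti t s)"
    unfolding rowT_def sum_distrib_left sum_distrib_right
    by (subst sum.swap) (simp add: mult.assoc)
  also have "\<dots> = 0" by (simp add: rowT0)
  finally show ?thesis .
qed

lemma rowT_mult_Ti:
  assumes "i < N" "s < N"
  shows "rowT (\<lambda>r. p * Ti i r) s = p * (if i = s then 1 else 0)"
  using assms by (simp add: rowT_def mult.assoc Ti_T flip: sum_distrib_left)

text \<open>Row \<open>i\<close> of the inverse becomes a unit row after multiplication by
  \<open>T\<close>, so this test row singles out one scalar functional of the sum.\<close>

lemma form_mult_Ti:
  assumes "i < N"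
  shows "form q (\<lambda>r. p * Ti i r) = L i (rowT q i * p)"
proof -
  have "form q (\<lambda>r. p * Ti i r) = (\<Sum>s<N. if i = s then L s (rowT q s * p) else 0)"
    unfolding form_def using assms by (intro sum.cong) (auto simp: rowT_mult_Ti L_lin)
  then show ?thesis using assms by simp
qed

text \<open>An operator with eigenfunctions \<open>Q n\<close> has a formal adjoint. It is not needed that the adjoint is
  again a differential operator, only that it maps polynomials to polynomials.\<close>

lemma conjugated_entry_adjoint:
  assumes X: "\<And>r c. r < N \<Longrightarrow> c < N \<Longrightarrow> linear_op (X r c)"
    and eig: "\<And>n k c. k < N \<Longrightarrow> c < N \<Longrightarrow>
      (\<Sum>r<N. X r c (Q n k r)) = (\<Sum>l<N. smult (\<Lambda> n k l) (Q n l c))"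
    and ij: "i < N" "j < N"
  shows "\<exists>v. \<forall>p. L j ((\<Sum>c<N. (\<Sum>s<N. X s c (p * Ti i s)) * T c j) * q) = L i (p * v)"
proof -
  define Xr where "Xr R c = (\<Sum>r<N. X r c (R r))" for R c
  \<comment> \<open>The entry (i,j) of \<open>T\<^sup>-\<^sup>1 X T\<close>: multiply by row
    \<open>i\<close> of \<open>Ti\<close>, apply \<open>X\<close>, multiply by column
    \<open>j\<close> of \<open>T\<close>.\<close>
  define E where "E p = (\<Sum>c<N. (\<Sum>s<N. X s c (p * Ti i s)) * T c j)" for p
  define \<phi> where "\<phi> p = L j (E p * q)" for p
  have E_rowT: "E p = rowT (Xr (\<lambda>s. p * Ti i s)) j" for p
    by (simp add: E_def rowT_def Xr_def)
  obtain d where d: "deg_below d q" using deg_below_Suc_degree by blast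
  \<comment> \<open>Components of index at most \<open>d\<close> have degree at most
    \<open>d\<close>, and \<open>T\<close> adds one degree; hence the strict bound d + 2.\<close>
  define K where "K = Suc (Suc d)"
  have "E (p + p') = E p + E p'" for p p'
    using ij by (simp add: E_def linear_opD[OF X] distrib_right sum.distrib)
  moreover have "E (smult c p) = smult c (E p)" for c p
    using ij by (simp add: E_def linear_opD[OF X] flip: smult_sum_right)
  ultimately have \<phi>_lin: "linear_functional \<phi>"
    using ij by (simp add: \<phi>_def linear_functional_def distrib_right L_lin)
  note lin\<phi> = linear_functionalD[OF \<phi>_lin]
  \<comment> \<open>\<open>\<phi>\<close> sees \<open>p\<close> only through its pairings with
    degrees below \<open>K\<close>. Split the row \<open>p * Ti i\<close> into components
    \<open>w l\<close> in the span of the rows \<open>Q l\<close>: those with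
    \<open>l \<le> d\<close> vanish by the hypothesis on \<open>p\<close>, and \<open>X\<close>
    keeps the others in the same span, which is orthogonal to the low-degree row
    \<open>q * Ti j\<close>.\<close>
  have key: "\<phi> p = 0" if p: "\<And>q'. deg_below K q' \<Longrightarrow> L i (p * q') = 0" for p
  proof -
    define R where "R s = p * Ti i s" for s
    obtain M where M: "\<forall>s<N. deg_below M (R s)" using ex_deg_below by blast
    obtain c where c: "\<forall>s<N. R s = (\<Sum>n<M. \<Sum>k<N. smult (c n k) (Q n k s))"
      using monic_family_span[OF monic M] by blast
    define w where "w l s = (\<Sum>k<N. smult (c l k) (Q l k s))" for l s
    have w_form: "form (w l) f = (\<Sum>k<N. c l k * form (Q l k) f)" for l f
      unfolding w_def by (simp add: form_sum form_smult)
    have w_cnj: "form (w l) (\<lambda>r. map_poly cnj (w m r)) = 0" if "l \<noteq> m" for l m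
    proof -
      have "form (Q l k) (\<lambda>r. map_poly cnj (w m r)) = 0" if "k < N" for k
      proof -
        have "form (\<lambda>r. map_poly cnj (w m r)) (Q l k)
            = (\<Sum>k'<N. cnj (c m k') * form (\<lambda>r. map_poly cnj (Q m k' r)) (Q l k))"
          unfolding w_def by (simp add: map_poly_cnj_sum map_poly_cnj_smult form_sum form_smult)
        also have "\<dots> = 0"
          using that \<open>l \<noteq> m\<close> by (simp add: form_commute[of _ "Q l k"] form_orth)
        finally show ?thesis by (simp add: form_commute)
      qed
      then show ?thesis by (simp add: w_form)
    qed
    have R_form: "form R f = (\<Sum>l<M. form (w l) f)" for f
      unfolding form_sum[symmetric] using c by (intro form_cong) (simp add: w_def)
    have w_deg: "deg_below (Suc l) (w l s)" if "s < N" for l s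
      unfolding w_def using monic that
      by (intro deg_below_sum deg_below_smult) (auto simp: monic_family_def)
    \<comment> \<open>Pairing \<open>R\<close> with the conjugate of \<open>w l\<close> leaves only
      the norm of \<open>w l\<close>, different components being orthogonal.\<close>
    have w0: "w l s = 0" if l: "l < M" "l \<le> d" and s: "s < N" for l s
    proof -
      have "deg_below K (rowT (\<lambda>r. map_poly cnj (w l r)) i)"
        unfolding rowT_def K_def using l w_deg ij
        by (intro deg_below_sum deg_below_mult_linear T_deg)
          (auto intro!: deg_below_cnj intro: deg_below_mono)
      then have "L i (p * rowT (\<lambda>r. map_poly cnj (w l r)) i) = 0" by (rule p)
      then have "form R (\<lambda>r. map_poly cnj (w l r)) = 0"
        unfolding R_def by (subst form_commute) (simp add: form_mult_Ti[OF ij(1)] mult.commute)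
      moreover have "form R (\<lambda>r. map_poly cnj (w l r)) = form (w l) (\<lambda>r. map_poly cnj (w l r))"
      proof -
        have "form R (\<lambda>r. map_poly cnj (w l r))
            = (\<Sum>m<M. if m = l then form (w l) (\<lambda>r. map_poly cnj (w l r)) else 0)"
          unfolding R_form by (intro sum.cong) (auto simp: w_cnj)
        then show ?thesis using l by simp
      qed
      ultimately show ?thesis using form_cnj_self_0 s by simp
    qed
    have Xw: "form (Xr (w l)) (\<lambda>r. q * Ti j r) = 0" if "l < M" for l
    proof (cases "l \<le> d")
      case True
      have "Xr (w l) s = 0" if "s < N" for s
        using w0[OF \<open>l < M\<close> True] X that by (simp add: Xr_def linear_opD)
      then have "form (Xr (w l)) (\<lambda>r. q * Ti j r) = form (\<lambda>_. \<Sum>i\<in>{}. 0) (\<lambda>r. q * Ti j r)"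
        by (intro form_cong) simp
      then show ?thesis unfolding form_sum by simp
    next
      case False
      have "Xr (w l) s = (\<Sum>k<N. \<Sum>m<N. smult (c l k * \<Lambda> l k m) (Q l m s))" if "s < N" for s
      proof -
        have "Xr (w l) s = (\<Sum>r<N. \<Sum>k<N. smult (c l k) (X r s (Q l k r)))"
          unfolding Xr_def w_def using X that by (intro sum.cong) (auto simp: linear_opD)
        also have "\<dots> = (\<Sum>k<N. smult (c l k) (\<Sum>r<N. X r s (Q l k r)))"
          by (subst sum.swap) (simp add: smult_sum_right)
        finally show ?thesis using that by (simp add: eig smult_sum_right)
      qed
      then have "form (Xr (w l)) (\<lambda>r. q * Ti j r)
          = form (\<lambda>s. \<Sum>k<N. \<Sum>m<N. smult (c l k * \<Lambda> l k m) (Q l m s)) (\<lambda>r. q * Ti j r)"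
        by (rule form_cong)
      moreover have "form (Q l m) (\<lambda>r. q * Ti j r) = 0" if "m < N" for m
      proof (rule form_orth_below[OF that], intro allI impI)
        fix s assume "s < N"
        then have "deg_below (Suc d) (q * Ti j s)" using d ij by (intro deg_below_mult_linear Ti_deg)
        then show "deg_below l (q * Ti j s)" using False by (auto intro: deg_below_mono)
      qed
      ultimately show ?thesis by (simp add: form_sum form_smult)
    qed
    have "Xr R s = (\<Sum>l<M. Xr (w l) s)" if "s < N" for s
    proof -
      have "Xr R s = (\<Sum>r<N. \<Sum>l<M. X r s (w l r))"
        unfolding Xr_def
      proof (intro sum.cong refl)
        fix r assume r: "r \<in> {..<N}"
        then have "R r = (\<Sum>l<M. w l r)" using c by (simp add: w_def)
        then show "X r s (R r) = (\<Sum>l<M. X r s (w l r))" using r X that by (simp add: linear_opD)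
      qed
      then show ?thesis unfolding Xr_def by (subst sum.swap) simp
    qed
    then have "form (Xr R) (\<lambda>r. q * Ti j r) = form (\<lambda>s. \<Sum>l<M. Xr (w l) s) (\<lambda>r. q * Ti j r)"
      by (rule form_cong)
    also have "\<dots> = 0" by (simp add: form_sum Xw)
    finally have "L j (rowT (Xr R) j * q) = 0" by (simp only: form_mult_Ti[OF ij(2)])
    moreover have "R = (\<lambda>s. p * Ti i s)" by (simp add: R_def fun_eq_iff)
    ultimately show "\<phi> p = 0" unfolding \<phi>_def E_rowT by simp
  qed
  obtain v where v: "deg_below K v" "\<And>p. deg_below K p \<Longrightarrow> \<phi> p = L i (p * v)"
    using riesz_below[OF pos[OF ij(1)] \<phi>_lin] by blast
  have "\<phi> p = L i (p * v)" for p
  proof -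
    \<comment> \<open>\<open>p0\<close> is the projection of \<open>p\<close> to degrees below
      \<open>K\<close>. By \<open>key\<close>, \<open>\<phi>\<close> agrees on both, and since
      \<open>v\<close> has degree below \<open>K\<close>, pairing it with \<open>p0\<close> or with
      \<open>p\<close> is the same.\<close>
    have "linear_functional (\<lambda>q. L i (q * p))"
      by (intro linear_functional_mult positive_functionalD pos ij)
    then obtain p0 where p0: "deg_below K p0" "\<And>q. deg_below K q \<Longrightarrow> L i (q * p) = L i (q * p0)"
      using riesz_below[OF pos[OF ij(1)]] by blast
    have "\<phi> (p - p0) = 0"
    proof (rule key)
      fix q' :: "complex poly" assume "deg_below K q'"
      moreover have "L i ((p - p0) * q') = L i (q' * p) - L i (q' * p0)"
        unfolding L_lin(4)[OF ij(1), symmetric] by (simp add: algebra_simps)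
      ultimately show "L i ((p - p0) * q') = 0" using p0(2) by simp
    qed
    then have "\<phi> p = \<phi> p0" by (simp add: lin\<phi>)
    also have "\<dots> = L i (v * p0)" using v(2)[OF p0(1)] by (simp add: mult.commute)
    also have "\<dots> = L i (p * v)" using p0(2)[OF v(1)] by (simp add: mult.commute)
    finally show ?thesis .
  qed
  then show ?thesis unfolding \<phi>_def E_def by blast
qed

end

text \<open>Commuting with \<open>x\<close> lowers the order of \<open>U\<close> and preserves the existence of an adjoint, so the
  problem reduces to multiplication operators.\<close>

lemma adjoint_between_incompatible_functionals:
  assumes "linear_functional Li" "linear_functional Lj"
    and incompat: "\<And>u v. (\<And>p. Lj (u * p) = Li (v * p)) \<Longrightarrow> u = 0"
    and "order_below k U" "\<And>q. \<exists>v. \<forall>p. Lj (U p * q) = Li (p * v)"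
  shows "U p = 0"
  using assms(4,5)
proof (induction k arbitrary: U p)
  case 0
  then show ?case by (simp add: order_below_0_iff)
next
  case (Suc k)
  note Li = linear_functionalD[OF assms(1)] and Lj = linear_functionalD[OF assms(2)]
  have U: "linear_op U" "order_below k (x_comm U)" using Suc.prems by (auto simp: order_below_Suc_iff)
  \<comment> \<open>The adjoint of [U,x] at \<open>q\<close> is x times the adjoint of
    \<open>U\<close> at \<open>q\<close>, minus the adjoint of \<open>U\<close> at x q.\<close>
  have "\<exists>v. \<forall>p. Lj (x_comm U p * q) = Li (p * v)" for q
  proof -
    obtain v where v: "\<And>p. Lj (U p * q) = Li (p * v)" using Suc.prems(2) by blast
    obtain v' where v': "\<And>p. Lj (U p * ([:0,1:] * q)) = Li (p * v')" using Suc.prems(2) by blast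
    have "Lj (x_comm U p * q) = Li (p * ([:0,1:] * v - v'))" for p
    proof -
      have "Lj (x_comm U p * q) = Lj (U ([:0,1:] * p) * q) - Lj (U p * ([:0,1:] * q))"
        by (simp only: x_comm_def Lj(4)[symmetric] left_diff_distrib mult.assoc mult.left_commute)
      also have "\<dots> = Li (p * ([:0,1:] * v - v'))"
        by (simp only: v v' Li(4)[symmetric] right_diff_distrib mult.assoc mult.left_commute)
      finally show ?thesis .
    qed
    then show ?thesis by blast
  qed
  then have comm: "x_comm U p = 0" for p using Suc.IH U(2) by blast
  \<comment> \<open>An operator commuting with x is multiplication by its value at 1; its adjoint at
    \<open>q = 1\<close> then relates the two functionals by polynomial factors.\<close>
  have mult: "U p = U 1 * p" for p
  proof (induction p)
    case 0
    then show ?case by (simp add: linear_opD[OF U(1)])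
  next
    case (pCons a p)
    have "pCons a p = smult a 1 + [:0,1:] * p" by simp
    then have "U (pCons a p) = smult a (U 1) + U ([:0,1:] * p)"
      using linear_opD(1,2)[OF U(1)] by metis
    also have "U ([:0,1:] * p) = [:0,1:] * U p" using comm[of p] by (simp add: x_comm_def)
    finally show ?case using pCons by simp
  qed
  obtain v where v: "\<And>p. Lj (U p * 1) = Li (p * v)" using Suc.prems(2) by blast
  have "U 1 = 0"
  proof (rule incompat)
    show "Lj (U 1 * p) = Li (v * p)" for p using v[of p] mult[of p] by (simp add: mult.commute)
  qed
  then show ?case using mult[of p] by simp
qed


text \<open>With 0-based indices the odd rows of A vanish, so row 1 of \<open>T\<close> and of
  \<open>Ti\<close> is a unit row, while the only off-diagonal entry in row 0 of \<open>T\<close> is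
  \<open>a\<close> x. The last assumption excludes that a nonzero polynomial multiple of one weight
  is a polynomial multiple of another.\<close>

locale orthogonal_rows_linear = orthogonal_rows +
  fixes a :: complex
  assumes N2: "2 \<le> N" and a: "a \<noteq> 0"
    and T0: "c < N \<Longrightarrow> T 0 c = (if c = 0 then 1 else if c = 1 then [:0, a:] else 0)"
    and T1: "c < N \<Longrightarrow> T 1 c = (if c = 1 then 1 else 0)"
    and Ti0: "Ti 0 0 = 1" "Ti 0 1 = [:0, -a:]"
    and Ti1: "c < N \<Longrightarrow> Ti 1 c = (if c = 1 then 1 else 0)"
    and incompat: "i < N \<Longrightarrow> j < N \<Longrightarrow> i \<noteq> j \<Longrightarrow> (\<And>p. L j (u * p) = L i (v * p)) \<Longrightarrow> u = 0"
begin

text \<open>The operator \<open>T\<^sup>-\<^sup>1 X T\<close> is diagonal by incompatibility. As \<open>X\<close> does not raise degrees, its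
  \<open>(0,1)\<close> entry ties the leading coefficient of the diagonal entry \<open>0\<close> at \<open>x\<^sup>n\<close> to that of the
  diagonal entry \<open>1\<close> at \<open>x\<^sup>n\<^sup>+\<^sup>1\<close>, and the vanishing minor then kills both.\<close>

lemma eigenvalue_row_zero:
  assumes X: "\<And>r c. r < N \<Longrightarrow> c < N \<Longrightarrow> finite_order (X r c)"
    and eig: "\<And>n k c. k < N \<Longrightarrow> c < N \<Longrightarrow>
      (\<Sum>r<N. X r c (Q n k r)) = (\<Sum>l<N. smult (\<Lambda> n k l) (Q n l c))"
    and minor: "\<And>n. \<Lambda> n 0 0 * \<Lambda> n 1 1 = \<Lambda> n 0 1 * \<Lambda> n 1 0"
    and c: "c < N"
  shows "\<Lambda> n 1 c = 0"
proof -
  have N: "0 < N" "Suc 0 < N" using N2 by auto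
  have Xlin: "linear_op (X r c)" if "r < N" "c < N" for r c
    using X that finite_order_linear by blast
  define E where "E i j p = (\<Sum>c<N. (\<Sum>s<N. X s c (p * Ti i s)) * T c j)" for i j p
  have E_fin: "finite_order (E i j)" if "i < N" "j < N" for i j
    unfolding E_def
  proof (intro finite_order_sum finite_order_mult)
    fix c s assume "c \<in> {..<N}" "s \<in> {..<N}"
    then show "finite_order (\<lambda>p. X s c (p * Ti i s))"
      using finite_order_comp[OF X finite_order_mult[OF finite_order_id]] by simp
  qed
  have E_off: "E i j p = 0" if ij: "i < N" "j < N" "i \<noteq> j" for i j p
  proof -
    obtain k where "order_below k (E i j)" using E_fin ij by (auto simp: finite_order_def)
    moreover have "\<exists>v. \<forall>p. L j (E i j p * q) = L i (p * v)" for q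
      unfolding E_def using conjugated_entry_adjoint[OF Xlin eig] ij by blast
    ultimately show ?thesis
      using adjoint_between_incompatible_functionals[of "L i" "L j" k "E i j" p] incompat ij
        positive_functionalD(1)[OF pos] by blast
  qed
  \<comment> \<open>With the off-diagonal entries gone, undoing the conjugation gives
    \<open>X = T diag(E j j) T\<^sup>-\<^sup>1\<close>.\<close>
  have X_E: "X r c p = (\<Sum>j<N. E j j (p * T r j) * Ti j c)" if rc: "r < N" "c < N" for r c p
  proof -
    have row: "E j j (p * T r j) = (\<Sum>c<N. X r c p * T c j)" if j: "j < N" for j
    proof -
      have "E j j (p * T r j) = (\<Sum>i<N. if i = j then E i j (p * T r i) else 0)" using j by simp
      also have "\<dots> = (\<Sum>i<N. E i j (p * T r i))" using j by (intro sum.cong) (auto simp: E_off)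
      also have "\<dots> = (\<Sum>c<N. \<Sum>i<N. (\<Sum>s<N. X s c (p * T r i * Ti i s)) * T c j)"
        unfolding E_def by (rule sum.swap)
      also have "\<dots> = (\<Sum>c<N. (\<Sum>i<N. \<Sum>s<N. X s c (p * T r i * Ti i s)) * T c j)"
        by (simp add: sum_distrib_right)
      also have "\<dots> = (\<Sum>c<N. X r c p * T c j)"
      proof (intro sum.cong refl)
        fix c assume c: "c \<in> {..<N}"
        have "(\<Sum>i<N. \<Sum>s<N. X s c (p * T r i * Ti i s)) = (\<Sum>s<N. \<Sum>i<N. X s c (p * T r i * Ti i s))"
          by (rule sum.swap)
        also have "\<dots> = (\<Sum>s<N. X s c (p * (\<Sum>i<N. T r i * Ti i s)))"
          using c by (intro sum.cong) (auto simp: linear_opD[OF Xlin] sum_distrib_left mult.assoc)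
        also have "\<dots> = (\<Sum>s<N. if s = r then X s c p else 0)"
          using c rc by (intro sum.cong) (auto simp: T_Ti linear_opD[OF Xlin])
        also have "\<dots> = X r c p" using rc by simp
        finally show "(\<Sum>i<N. \<Sum>s<N. X s c (p * T r i * Ti i s)) * T c j = X r c p * T c j" by simp
      qed
      finally show ?thesis .
    qed
    have "(\<Sum>j<N. E j j (p * T r j) * Ti j c) = (\<Sum>j<N. (\<Sum>c<N. X r c p * T c j) * Ti j c)"
      by (intro sum.cong) (auto simp: row)
    also have "\<dots> = (\<Sum>d<N. X r d p * (\<Sum>j<N. T d j * Ti j c))"
      unfolding sum_distrib_left sum_distrib_right
      by (subst sum.swap) (simp add: mult.assoc)
    also have "\<dots> = X r c p"
      using rc by (simp add: T_Ti sum_delta_mult)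
    finally show ?thesis by simp
  qed
  have E0: "E j j 0 = 0" if "j < N" for j
    using linear_opD(3)[OF finite_order_linear[OF E_fin]] that by blast
  have X1: "X 1 c p = (if c = 1 then E 1 1 p else 0)" if "c < N" for c p
  proof -
    have "X 1 c p = (\<Sum>j<N. if j = 1 then E j j p * Ti 1 c else 0)"
      unfolding X_E[OF N(2)[folded One_nat_def] that] using N
      by (intro sum.cong) (auto simp: T1[unfolded One_nat_def] E0)
    then show ?thesis using N that by (simp add: Ti1[unfolded One_nat_def])
  qed
  have X0: "X 0 c p = E 0 0 p * Ti 0 c + E 1 1 (p * [:0, a:]) * Ti 1 c" if "c < N" for c p
  proof -
    have "X 0 c p = (\<Sum>j\<in>{0,1}. E j j (p * T 0 j) * Ti j c)"
      unfolding X_E[OF N(1) that] using N by (intro sum.mono_neutral_right) (auto simp: T0 E0)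
    then show ?thesis using N by (simp add: T0)
  qed
  \<comment> \<open>\<open>Q n r\<close> is x^n in position \<open>r\<close> plus terms of lower
    degree, and \<open>X\<close> maps rows of degree below n to such rows because it keeps the span
    of each \<open>Q m\<close>. So the coefficient at n is the eigenvalue entry, and nothing lies
    above it.\<close>
  have lead: "coeff (X r c (monom 1 n)) m = (if m = n then \<Lambda> n r c else 0)"
    if rc: "r < N" "c < N" and m: "n \<le> m" for r c n m
  proof -
    define q where "q s = Q n r s - (if r = s then monom 1 n else 0)" for s
    have "deg_below n (q s)" if "s < N" for s
    proof -
      have "deg_below (Suc n) (Q n r s)" "coeff (Q n r s) n = (if r = s then 1 else 0)"
        using monic rc that by (auto simp: monic_family_def)
      then show ?thesis using deg_below_Suc_decomp[of n "Q n r s"] by (auto simp: q_def split: if_splits)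
    qed
    then obtain b where b: "\<forall>s<N. q s = (\<Sum>m<n. \<Sum>k<N. smult (b m k) (Q m k s))"
      using monic_family_span[OF monic] by blast
    have "(\<Sum>s<N. X s c (q s)) = (\<Sum>s<N. \<Sum>m<n. \<Sum>k<N. smult (b m k) (X s c (Q m k s)))"
      using b rc by (intro sum.cong) (auto simp: linear_opD[OF Xlin])
    also have "\<dots> = (\<Sum>m<n. \<Sum>s<N. \<Sum>k<N. smult (b m k) (X s c (Q m k s)))"
      by (rule sum.swap)
    also have "\<dots> = (\<Sum>m<n. \<Sum>k<N. smult (b m k) (\<Sum>s<N. X s c (Q m k s)))"
      unfolding smult_sum_right by (rule sum.cong[OF refl]) (rule sum.swap)
    also have "\<dots> = (\<Sum>m<n. \<Sum>k<N. smult (b m k) (\<Sum>l<N. smult (\<Lambda> m k l) (Q m l c)))"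
      using rc by (simp add: eig)
    finally have low_eq: "(\<Sum>s<N. X s c (q s)) = \<dots>" .
    have "deg_below n (\<Sum>s<N. X s c (q s))"
      unfolding low_eq
    proof (intro deg_below_sum deg_below_smult)
      fix m k l assume "m \<in> {..<n}" "k \<in> {..<N}" "l \<in> {..<N}"
      then have "deg_below (Suc m) (Q m l c)" "Suc m \<le> n"
        using monic rc by (auto simp: monic_family_def)
      then show "deg_below n (Q m l c)" by (rule deg_below_mono)
    qed
    moreover have "(\<Sum>s<N. X s c (Q n r s)) = X r c (monom 1 n) + (\<Sum>s<N. X s c (q s))"
    proof -
      have "(\<Sum>s<N. X s c (Q n r s)) = (\<Sum>s<N. (if s = r then X s c (monom 1 n) else 0) + X s c (q s))"
        using rc by (intro sum.cong) (auto simp: q_def linear_opD[OF Xlin])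
      then show ?thesis using rc by (simp add: sum.distrib)
    qed
    ultimately have "coeff (X r c (monom 1 n)) m = coeff (\<Sum>l<N. smult (\<Lambda> n r l) (Q n l c)) m"
      using m rc by (simp add: eig[symmetric] deg_below_def)
    also have "\<dots> = (\<Sum>l<N. if l = c then (if m = n then \<Lambda> n r c else 0) else 0)"
      unfolding coeff_sum
    proof (intro sum.cong refl)
      fix l assume "l \<in> {..<N}"
      then have "deg_below (Suc n) (Q n l c)" "coeff (Q n l c) n = (if l = c then 1 else 0)"
        using monic rc by (auto simp: monic_family_def)
      then show "coeff (smult (\<Lambda> n r l) (Q n l c)) m = (if l = c then (if m = n then \<Lambda> n r c else 0) else 0)"
        using m by (cases "m = n") (auto simp: deg_below_def)
    qed
    finally show ?thesis using rc by simp
  qed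
  have L10: "\<Lambda> n 1 c = 0" if "c < N" "c \<noteq> 1" for n c
    using lead[of 1 c n n] X1[OF that(1)] that N by simp
  have L11: "\<Lambda> n 1 1 = coeff (E 1 1 (monom 1 n)) n" for n
    using lead[of 1 1 n n] X1[of 1] N by simp
  have L00: "\<Lambda> n 0 0 = coeff (E 0 0 (monom 1 n)) n" for n
    using lead[of 0 0 n n] X0[of 0 "monom 1 n"] N Ti1[of 0] by (simp add: Ti0)
  have shift: "\<Lambda> n 0 0 = \<Lambda> (Suc n) 1 1" for n
  proof -
    have "monom 1 n * [:0, a:] = smult a (monom 1 (Suc n))" by (simp add: monom_Suc)
    then have "E 1 1 (monom 1 n * [:0, a:]) = smult a (E 1 1 (monom 1 (Suc n)))"
      using linear_opD(2)[OF finite_order_linear[OF E_fin]] N by simp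
    then have "X 0 1 (monom 1 n) = E 0 0 (monom 1 n) * [:0, -a:] + smult a (E 1 1 (monom 1 (Suc n)))"
      using X0[of 1 "monom 1 n"] N Ti1[of 1] Ti0 by simp
    moreover have "coeff (X 0 1 (monom 1 n)) (Suc n) = 0" using lead[of 0 1 n "Suc n"] N by simp
    ultimately have "- a * coeff (E 0 0 (monom 1 n)) n + a * coeff (E 1 1 (monom 1 (Suc n))) (Suc n) = 0"
      by simp
    then have "a * (\<Lambda> (Suc n) 1 1 - \<Lambda> n 0 0) = 0"
      unfolding L00 L11 by (simp add: algebra_simps)
    then show ?thesis using a by simp
  qed
  have "\<Lambda> n 1 1 = 0" for n
    unfolding L11
  proof (rule finite_order_consecutive_zeros)
    show "finite_order (E 1 1)" using E_fin N by simp
    fix n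
    \<comment> \<open>As \<open>\<Lambda> n 1 0 = 0\<close>, the minor leaves
      \<open>\<Lambda> n 0 0 * \<Lambda> n 1 1 = 0\<close>, and \<open>shift\<close> makes this a
      product of consecutive values of one sequence.\<close>
    have "\<Lambda> (Suc n) 1 1 * \<Lambda> n 1 1 = 0"
      using minor[of n] L10[of 0 n] N unfolding shift by simp
    then show "coeff (E 1 1 (monom 1 n)) n = 0 \<or> coeff (E 1 1 (monom 1 (Suc n))) (Suc n) = 0"
      unfolding L11 by auto
  qed
  then show ?thesis using L10 c by (cases "c = 1") auto
qed

end

section \<open>Pearson equations and weight functionals\<close>

text \<open>Formally \<open>\<psi>\<close> is \<open>(\<phi> w)' / w\<close>, and
  \<open>w\<^sub>j / w\<^sub>i = v / u\<close>; the identity is the logarithmic derivative of this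
  quotient, cleared of denominators.\<close>

lemma pearson_compatibility:
  assumes Li: "positive_functional Li" and Lj: "positive_functional Lj"
    and pi: "\<And>p. Li (\<phi> * pderiv p + \<psi>i * p) = 0"
    and pj: "\<And>p. Lj (\<phi> * pderiv p + \<psi>j * p) = 0"
    and uv: "\<And>p. Lj (u * p) = Li (v * p)"
  shows "(\<psi>j - \<psi>i) * (u * v) = \<phi> * (pderiv v * u - pderiv u * v)"
proof -
  define g where "g = (\<psi>j - \<psi>i) * (u * v) - \<phi> * (pderiv v * u - pderiv u * v)"
  note lin = linear_functionalD[OF positive_functionalD(1)[OF Li]]
  have "Li (g * p) = 0" for p
  proof -
    \<comment> \<open>One factor \<open>u\<close> of the test polynomial is spent on passing from
      \<open>Lj\<close> to \<open>Li\<close>; the other matches the test polynomial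
      \<open>v * (u * p)\<close> used for \<open>Li\<close>, so that the terms with
      \<open>pderiv p\<close> cancel.\<close>
    have "\<phi> * pderiv (u * (u * p)) + \<psi>j * (u * (u * p))
        = u * (\<phi> * (2 * pderiv u * p + u * pderiv p) + \<psi>j * (u * p))"
      by (simp add: pderiv_mult algebra_simps)
    then have 1: "Li (v * (\<phi> * (2 * pderiv u * p + u * pderiv p) + \<psi>j * (u * p))) = 0"
      using pj[of "u * (u * p)"] uv by simp
    have "g * p = v * (\<phi> * (2 * pderiv u * p + u * pderiv p) + \<psi>j * (u * p))
        - (\<phi> * pderiv (v * (u * p)) + \<psi>i * (v * (u * p)))"
      by (simp add: g_def pderiv_mult algebra_simps)
    then have "Li (g * p) = Li (v * (\<phi> * (2 * pderiv u * p + u * pderiv p) + \<psi>j * (u * p)))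
        - Li (\<phi> * pderiv (v * (u * p)) + \<psi>i * (v * (u * p)))"
      by (simp only: lin(4))
    then show ?thesis using 1 pi[of "v * (u * p)"] by simp
  qed
  then have "g = 0" using positive_functionalD(3)[OF Li, of g] by simp
  then show ?thesis by (simp add: g_def)
qed

text \<open>The logarithmic derivative v'/v - u'/u has at \<open>a\<close> the residue
  \<open>s - r\<close>, the difference of the root orders.\<close>

lemma pearson_root_integer:
  fixes u v h k :: "complex poly"
  assumes eq: "h * (u * v) = [:-a, 1:] * k * (pderiv v * u - pderiv u * v)"
    and nz: "u \<noteq> 0" "v \<noteq> 0"
  shows "\<exists>m::int. poly h a = poly k a * of_int m"
proof -
  define X where "X = [:-a, 1:]"
  define r s where "r = Polynomial.order a u" and "s = Polynomial.order a v"
  obtain u1 where u1: "u = X ^ r * u1" "\<not> X dvd u1"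
    using order_decomp[OF nz(1), of a] unfolding r_def X_def by blast
  obtain v1 where v1: "v = X ^ s * v1" "\<not> X dvd v1"
    using order_decomp[OF nz(2), of a] unfolding s_def X_def by blast
  have X: "pderiv X = 1" by (simp add: X_def pderiv_pCons)
  have dX: "X * pderiv (X ^ n) = of_nat n * X ^ n" for n
  proof (induction n)
    case (Suc n)
    have "X * pderiv (X ^ Suc n) = X * X ^ n + X * (X * pderiv (X ^ n))"
      by (simp add: pderiv_mult X algebra_simps)
    then show ?case unfolding Suc by (simp add: algebra_simps)
  qed simp
  \<comment> \<open>The Euler operator X d/dX does not lower the power of X, so after multiplying
    through, \<open>X ^ (r + s)\<close> cancels and the equation can be evaluated at
    \<open>a\<close>.\<close>
  have dX': "X * pderiv (X ^ n * t) = X ^ n * (of_nat n * t + X * pderiv t)" for n t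
  proof -
    have "X * pderiv (X ^ n * t) = X ^ n * (X * pderiv t) + X * pderiv (X ^ n) * t"
      by (simp add: pderiv_mult algebra_simps)
    then show ?thesis unfolding dX by (simp add: algebra_simps)
  qed
  have "X ^ (r + s) * (h * (u1 * v1)) = h * (u * v)"
    unfolding u1(1) v1(1) by (simp add: power_add algebra_simps)
  also have "\<dots> = k * ((X * pderiv v) * u - (X * pderiv u) * v)"
    unfolding eq X_def by (simp add: algebra_simps)
  also have "\<dots> = X ^ (r + s) * (k * ((of_nat s * v1 + X * pderiv v1) * u1 - (of_nat r * u1 + X * pderiv u1) * v1))"
    unfolding u1(1) v1(1) dX' power_add by (simp add: algebra_simps)
  finally have "h * (u1 * v1) = k * ((of_nat s * v1 + X * pderiv v1) * u1 - (of_nat r * u1 + X * pderiv u1) * v1)"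
    by (simp add: X_def)
  from arg_cong[OF this, of "\<lambda>p. poly p a"]
  have "poly h a * (poly u1 a * poly v1 a) = poly k a * (of_nat s - of_nat r) * (poly u1 a * poly v1 a)"
    by (simp add: X_def algebra_simps)
  moreover have "poly u1 a \<noteq> 0" "poly v1 a \<noteq> 0"
    using u1(2) v1(2) by (simp_all add: X_def poly_eq_0_iff_dvd)
  ultimately have "poly h a = poly k a * (of_nat s - of_nat r)" by simp
  then show ?thesis by (intro exI[of _ "int s - int r"]) simp
qed

text \<open>Each term on the right has degree below \<open>degree u + degree v\<close>, where the
  left side has \<open>c\<close> times the product of the leading coefficients.\<close>

lemma pearson_constant:
  fixes u v :: "complex poly"
  assumes eq: "[:c:] * (u * v) = pderiv v * u - pderiv u * v" and "c \<noteq> 0"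
  shows "u * v = 0"
proof (rule ccontr)
  assume nz: "u * v \<noteq> 0"
  have 0: "coeff (pderiv p * q) (degree p + degree q) = 0" for p q :: "complex poly"
  proof (cases "degree p = 0")
    case True
    then have "pderiv p = 0" by (simp add: pderiv_eq_0_iff)
    then show ?thesis by simp
  next
    case False
    have "degree (pderiv p * q) \<le> degree (pderiv p) + degree q" by (rule degree_mult_le)
    also have "\<dots> < degree p + degree q" using False by (simp add: degree_pderiv)
    finally show ?thesis by (rule coeff_eq_0)
  qed
  have "coeff ([:c:] * (u * v)) (degree u + degree v) = 0"
    unfolding eq using 0[of v u] 0[of u v] by (simp add: add.commute)
  moreover have "coeff (u * v) (degree u + degree v) = lead_coeff u * lead_coeff v"
    by (rule coeff_mult_degree_sum)
  ultimately show False using nz assms(2) by simp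
qed

section \<open>Moment functionals of scalar weights\<close>

definition weight_functional :: "real set \<Rightarrow> (real \<Rightarrow> real) \<Rightarrow> complex poly \<Rightarrow> complex" where
  "weight_functional S w p = (LINT x:S|lborel. poly p (complex_of_real x) * complex_of_real (w x))"

definition finite_moments :: "real set \<Rightarrow> (real \<Rightarrow> real) \<Rightarrow> bool" where
  "finite_moments S w \<longleftrightarrow> (\<forall>k::nat. set_integrable lborel S (\<lambda>x. x ^ k * w x))"

lemma set_integrable_poly_weight:
  assumes "finite_moments S w"
  shows "set_integrable lborel S (\<lambda>x. poly p (complex_of_real x) * complex_of_real (w x))"
proof -
  have "integrable lborel (\<lambda>x. \<Sum>k\<le>degree p. coeff p k * complex_of_real (indicat_real S x *\<^sub>R (x ^ k * w x)))"
    using assms unfolding finite_moments_def set_integrable_def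
    by (intro Bochner_Integration.integrable_sum integrable_mult_right integrable_of_real) auto
  then show ?thesis
    unfolding set_integrable_def
    by (rule Bochner_Integration.integrable_cong[THEN iffD1, rotated -1])
      (auto simp: poly_altdef sum_distrib_right sum_distrib_left scaleR_conv_of_real mult_ac)
qed

lemma linear_weight_functional:
  assumes "finite_moments S w"
  shows "linear_functional (weight_functional S w)"
proof -
  note int = set_integrable_poly_weight[OF assms]
  have "weight_functional S w (p + q) = weight_functional S w p + weight_functional S w q" for p q
    unfolding weight_functional_def using set_integral_add(2)[OF int[of p] int[of q]]
    by (simp add: distrib_right)
  moreover have "weight_functional S w (smult c p) = c * weight_functional S w p" for c p
    unfolding weight_functional_def
    by (simp add: mult.assoc)
  ultimately show ?thesis by (simp add: linear_functional_def)
qed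

text \<open>If the integral of |p|^2 w vanishes, almost every point of \<open>S\<close> is a root of
  \<open>p\<close>; for \<open>p \<noteq> 0\<close> the roots form a null set, and the nonempty open
  set \<open>S\<close> would be null.\<close>

lemma positive_weight_functional:
  assumes mom: "finite_moments S w" and S: "open S" "S \<noteq> {}"
    and w: "AE x in lborel. x \<in> S \<longrightarrow> w x > 0"
  shows "positive_functional (weight_functional S w)"
proof -
  define I where "I p x = indicat_real S x * ((cmod (poly p (complex_of_real x)))\<^sup>2 * w x)" for p x
  have eq: "indicat_real S x *\<^sub>R (poly (p * map_poly cnj p) (complex_of_real x) * complex_of_real (w x))
      = complex_of_real (I p x)" for p x
    by (simp add: I_def scaleR_conv_of_real complex_norm_square del: of_real_power)
  have int: "integrable lborel (I p)" for p
    using set_integrable_poly_weight[OF mom, of "p * map_poly cnj p"]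
    unfolding set_integrable_def eq complex_of_real_integrable_eq .
  have L: "weight_functional S w (p * map_poly cnj p) = complex_of_real (integral\<^sup>L lborel (I p))" for p
    unfolding weight_functional_def set_lebesgue_integral_def eq by (rule integral_complex_of_real)
  have nn: "AE x in lborel. 0 \<le> I p x" for p
    using w by eventually_elim (auto simp: I_def indicator_def)
  have "p = 0" if "integral\<^sup>L lborel (I p) = 0" for p
  proof (rule ccontr)
    assume "p \<noteq> 0"
    have "AE x in lborel. I p x = 0"
      using integral_nonneg_eq_0_iff_AE[OF int nn] that by blast
    moreover have "AE x in lborel. poly p (complex_of_real x) \<noteq> 0"
    proof -
      have "finite (complex_of_real -` {z. poly p z = 0})"
        using poly_roots_finite[OF \<open>p \<noteq> 0\<close>] by (intro finite_vimageI) (auto simp: inj_on_def)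
      then have "complex_of_real -` {z. poly p z = 0} \<in> null_sets lborel"
        by (rule finite_imp_null_set_lborel)
      then show ?thesis by (rule AE_I') auto
    qed
    ultimately have "AE x in lborel. x \<notin> S"
      using w by eventually_elim (auto simp: I_def indicator_def split: if_splits)
    then have "S \<in> null_sets lborel"
      using S by (subst (asm) AE_iff_null_sets[symmetric]) auto
    then have "negligible S"
      by (simp add: negligible_iff_null_sets null_sets_completionI)
    then show False using S open_not_negligible by blast
  qed
  then show ?thesis
    unfolding positive_functional_def using linear_weight_functional[OF mom] integral_nonneg_AE[OF nn]
    by (auto simp: L)
qed

text \<open>For \<open>p\<close> = x^k the integrand is the derivative of
  \<open>x^k \<phi> w\<close>, whose boundary limits are zero. Endpoints in the extended reals cover
  all three supports at once.\<close>

lemma weight_functional_pearson: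
  fixes a b :: ereal and w \<phi> \<psi> :: "real \<Rightarrow> real"
  assumes ab: "a < b" and mom: "finite_moments (einterval a b) w"
    and \<phi>c: "\<And>x. poly \<phi>c (complex_of_real x) = complex_of_real (\<phi> x)"
    and \<psi>c: "\<And>x. poly \<psi>c (complex_of_real x) = complex_of_real (\<psi> x)"
    and deriv: "\<And>x. x \<in> einterval a b \<Longrightarrow> ((\<lambda>x. \<phi> x * w x) has_real_derivative \<psi> x * w x) (at x)"
    and cont: "\<And>x. x \<in> einterval a b \<Longrightarrow> isCont w x" "\<And>x. isCont \<phi> x" "\<And>x. isCont \<psi> x"
    and lim: "\<And>k::nat. (((\<lambda>x. x ^ k * (\<phi> x * w x)) \<circ> real_of_ereal) \<longlongrightarrow> 0) (at_right a)"
      "\<And>k::nat. (((\<lambda>x. x ^ k * (\<phi> x * w x)) \<circ> real_of_ereal) \<longlongrightarrow> 0) (at_left b)"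
  shows "weight_functional (einterval a b) w (\<phi>c * pderiv p + \<psi>c * p) = 0"
proof -
  let ?S = "einterval a b"
  note lin = linear_functionalD[OF linear_weight_functional[OF mom]]
  have mono: "weight_functional ?S w (\<phi>c * pderiv (monom 1 k) + \<psi>c * monom 1 k) = 0" for k
  proof -
    define f where "f x = real k * x ^ (k - 1) * (\<phi> x * w x) + x ^ k * (\<psi> x * w x)" for x
    have eq: "poly (\<phi>c * pderiv (monom 1 k) + \<psi>c * monom 1 k) (complex_of_real x) * complex_of_real (w x)
        = complex_of_real (f x)" for x
      by (simp add: f_def \<phi>c \<psi>c pderiv_monom poly_monom algebra_simps)
    have "set_integrable lborel ?S (\<lambda>x. complex_of_real (f x))"
      using set_integrable_poly_weight[OF mom, of "\<phi>c * pderiv (monom 1 k) + \<psi>c * monom 1 k"]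
      unfolding eq .
    then have int: "set_integrable lborel ?S f"
      unfolding set_integrable_def
      by (simp add: scaleR_conv_of_real complex_of_real_integrable_eq flip: of_real_mult)
    have "(LBINT x=a..b. f x) = 0 - 0"
    proof (rule interval_integral_FTC_integrable[OF ab _ _ int lim(1)[of k] lim(2)[of k]])
      fix x assume "a < ereal x" "ereal x < b"
      then have x: "x \<in> ?S" by (simp add: einterval_iff)
      have "((\<lambda>x. x ^ k * (\<phi> x * w x)) has_real_derivative f x) (at x)"
        unfolding f_def by (rule derivative_eq_intros deriv[OF x] refl | simp add: algebra_simps)+
      then show "((\<lambda>x. x ^ k * (\<phi> x * w x)) has_vector_derivative f x) (at x)"
        by (rule has_real_derivative_iff_has_vector_derivative[THEN iffD1])
      show "isCont f x"
        unfolding f_def by (intro continuous_intros cont x)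
    qed
    then have "(LINT x:?S|lborel. f x) = 0"
      using ab by (simp add: interval_lebesgue_integral_le_eq less_imp_le)
    then show ?thesis
      unfolding weight_functional_def eq by (simp add: set_integral_complex_of_real)
  qed
  have "p = (\<Sum>k\<le>degree p. smult (coeff p k) (monom 1 k))"
    by (simp add: smult_monom poly_as_sum_of_monoms)
  then obtain c n where p: "p = (\<Sum>k\<le>n. smult (c k) (monom 1 k))" by blast
  have B: "linear_op (\<lambda>p. \<phi>c * pderiv p + \<psi>c * p)"
    by (simp add: linear_op_def pderiv_add pderiv_smult smult_add_right algebra_simps)
  have "\<phi>c * pderiv p + \<psi>c * p = (\<Sum>k\<le>n. smult (c k) (\<phi>c * pderiv (monom 1 k) + \<psi>c * monom 1 k))"
    using linear_opD(5)[OF B, of "\<lambda>k. smult (c k) (monom 1 k)" "{..n}"]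
    unfolding linear_opD(2)[OF B] p .
  then show ?thesis by (simp only: lin(2,5) mono) simp
qed

section \<open>The classical weights\<close>

text \<open>If the product vanishes through \<open>v = 0\<close>, testing the relation on the
  conjugate of \<open>u\<close> makes the norm of \<open>u\<close> zero.\<close>

lemma weight_functional_eq_0:
  assumes "positive_functional Lj" "\<And>p. Lj (u * p) = Li (v * p)" "linear_functional Li" "u * v = 0"
  shows "u = 0"
proof (rule ccontr)
  assume "u \<noteq> 0"
  then have "v = 0" using assms(4) by simp
  then have "Lj (u * map_poly cnj u) = 0" using assms(2) linear_functionalD(3)[OF assms(3)] by simp
  then show False using positive_functionalD(3)[OF assms(1), of u] \<open>u \<noteq> 0\<close> by simp
qed

section \<open>Hermite weights\<close>

lemma finite_moments_hermite: "finite_moments UNIV (hermite_w b)"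
  unfolding finite_moments_def
proof
  fix k :: nat
  \<comment> \<open>Up to the factor \<open>sqrt pi * exp (b\<^sup>2)\<close> the weight is the
    normal density with mean \<open>b\<close> and variance 1/2; \<open>p\<close> rewrites x^k in
    powers of x - b, so that central moments apply.\<close>
  define \<sigma> :: real where "\<sigma> = 1 / sqrt 2"
  have \<sigma>: "\<sigma> > 0" "2 * \<sigma>\<^sup>2 = 1" by (simp_all add: \<sigma>_def power_divide)
  define p :: "real poly" where "p = pcompose (monom 1 k) [:b, 1:]"
  have p: "poly p (x - b) = x ^ k" for x by (simp add: p_def poly_pcompose poly_monom)
  have "integrable lborel (\<lambda>x. \<Sum>i\<le>degree p. coeff p i * (normal_density b \<sigma> x * (x - b) ^ i))"
    by (intro Bochner_Integration.integrable_sum integrable_mult_right integrable_normal_moment \<sigma>)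
  then have "integrable lborel (\<lambda>x. normal_density b \<sigma> x * poly p (x - b))"
    by (simp add: poly_altdef sum_distrib_left mult_ac)
  then have "integrable lborel (\<lambda>x. sqrt pi * exp (b\<^sup>2) * (normal_density b \<sigma> x * poly p (x - b)))"
    by (rule integrable_mult_right)
  moreover have "sqrt pi * exp (b\<^sup>2) * (normal_density b \<sigma> x * poly p (x - b)) = x ^ k * hermite_w b x" for x
  proof -
    have "exp (b\<^sup>2) * exp (- (x - b)\<^sup>2) = hermite_w b x"
      by (simp add: hermite_w_def power2_eq_square algebra_simps flip: exp_add)
    moreover have "normal_density b \<sigma> x = exp (- (x - b)\<^sup>2) / sqrt pi"
      using \<sigma> by (simp add: normal_density_def \<sigma>_def power_divide)
    ultimately show ?thesis by (simp add: p flip: \<open>_ = hermite_w b x\<close>)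
  qed
  ultimately show "set_integrable lborel UNIV (\<lambda>x. x ^ k * hermite_w b x)"
    by (simp add: set_integrable_def)
qed

lemma positive_hermite: "positive_functional (weight_functional UNIV (hermite_w b))"
  by (rule positive_weight_functional[OF finite_moments_hermite]) (auto simp: hermite_w_def)

lemma pearson_hermite:
  "weight_functional UNIV (hermite_w b) (1 * pderiv p + [:complex_of_real (2 * b), -2:] * p) = 0"
proof -
  have lim: "((\<lambda>x. x ^ k * (1 * hermite_w b x)) \<longlongrightarrow> 0) at_bot" "((\<lambda>x. x ^ k * (1 * hermite_w b x)) \<longlongrightarrow> 0) at_top" for k
    unfolding hermite_w_def by real_asymp+
  have "weight_functional (einterval (-\<infinity>) \<infinity>) (hermite_w b)
      (1 * pderiv p + [:complex_of_real (2 * b), -2:] * p) = 0"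
  proof (rule weight_functional_pearson[where \<phi> = "\<lambda>_. 1" and \<psi> = "\<lambda>x. 2 * b - 2 * x"])
    show "((\<lambda>x. 1 * hermite_w b x) has_real_derivative (2 * b - 2 * x) * hermite_w b x) (at x)" for x
      unfolding hermite_w_def by (rule derivative_eq_intros refl | simp add: algebra_simps)+
    show "isCont (hermite_w b) x" for x unfolding hermite_w_def by (intro continuous_intros)
  qed (use lim in \<open>auto simp: finite_moments_hermite ereal_tendsto_simps\<close>)
  then show ?thesis by simp
qed

text \<open>The quotient of the weights is exp (2 (b j - b i) x), with nonzero constant logarithmic
  derivative, whereas that of a rational function tends to 0 at infinity.\<close>

lemma hermite_incompatible:
  assumes "b i \<noteq> b j"
    and "\<And>p. weight_functional UNIV (hermite_w (b j)) (u * p) = weight_functional UNIV (hermite_w (b i)) (v * p)"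
  shows "u = 0"
proof -
  have "([:complex_of_real (2 * b j), -2:] - [:complex_of_real (2 * b i), -2:]) * (u * v)
      = 1 * (pderiv v * u - pderiv u * v)"
    by (rule pearson_compatibility[OF positive_hermite positive_hermite pearson_hermite pearson_hermite])
      (rule assms)
  then have "[:complex_of_real (2 * b j - 2 * b i):] * (u * v) = pderiv v * u - pderiv u * v" by simp
  then have "u * v = 0" using assms(1) by (intro pearson_constant) auto
  then show ?thesis
    using weight_functional_eq_0[OF positive_hermite assms(2)] positive_functionalD(1)[OF positive_hermite]
    by blast
qed

text \<open>Carries the Gamma and Beta integrals, given as gauge integrals over closed sets, to
  Lebesgue integrability on the open support.\<close>

lemma set_integrable_of_has_integral:
  fixes f :: "real \<Rightarrow> real"
  assumes "(f has_integral I) S'" "S \<subseteq> S'" "\<And>x. x \<in> S' \<Longrightarrow> 0 \<le> f x" "S \<in> sets borel"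
    "f \<in> borel_measurable borel"
  shows "set_integrable lborel S f"
proof -
  have "f absolutely_integrable_on S'"
    using assms(1,3) by (intro nonnegative_absolutely_integrable_1) (auto simp: integrable_on_def)
  then have "f absolutely_integrable_on S"
    by (rule set_integrable_subset) (use assms in auto)
  then have "integrable lebesgue (\<lambda>x. indicat_real S x *\<^sub>R f x)"
    by (simp add: set_integrable_def)
  then show ?thesis
    unfolding set_integrable_def using assms(4,5)
    by (subst (asm) integrable_completion) auto
qed

section \<open>Laguerre weights\<close>

lemma finite_moments_laguerre:
  assumes "\<alpha> > -1"
  shows "finite_moments {0<..} (laguerre_w \<alpha>)"
  unfolding finite_moments_def
proof
  fix k :: nat
  have "set_integrable lborel {0<..} (\<lambda>t. t powr (real k + \<alpha> + 1 - 1) / exp t)"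
    by (rule set_integrable_of_has_integral[OF Gamma_integral_real]) (use assms in auto)
  then show "set_integrable lborel {0<..} (\<lambda>x. x ^ k * laguerre_w \<alpha> x)"
    by (rule set_integrable_cong[THEN iffD1, rotated -1])
      (auto simp: laguerre_w_def powr_add powr_realpow exp_minus field_simps)
qed

lemma positive_laguerre:
  assumes "\<alpha> > -1"
  shows "positive_functional (weight_functional {0<..} (laguerre_w \<alpha>))"
proof (rule positive_weight_functional[OF finite_moments_laguerre[OF assms]])
  show "{0::real<..} \<noteq> {}" using greaterThan_non_empty by blast
qed (auto simp: laguerre_w_def)

lemma pearson_laguerre:
  assumes \<alpha>: "\<alpha> > -1"
  shows "weight_functional {0<..} (laguerre_w \<alpha>) ([:0, 1:] * pderiv p + [:complex_of_real (\<alpha> + 1), -1:] * p) = 0"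
proof -
  have lim: "((\<lambda>x. x ^ k * (x * laguerre_w \<alpha> x)) \<longlongrightarrow> 0) (at_right 0)"
    "((\<lambda>x. x ^ k * (x * laguerre_w \<alpha> x)) \<longlongrightarrow> 0) at_top" for k
  proof -
    \<comment> \<open>The factor x of the Pearson equation raises the exponent at 0 to
      \<open>\<alpha> + 1 > 0\<close>, so even an unbounded weight leaves no boundary term.\<close>
    have "((\<lambda>x. x ^ k * (exp (-x) * x powr (\<alpha> + 1))) \<longlongrightarrow> 0 ^ k * (exp (-0) * 0)) (at_right 0)"
      using \<alpha> by (intro tendsto_intros) (auto intro!: tendsto_zero_powrI eventually_at_right_less tendsto_ident_at simp: eventually_at_filter)
    moreover have "\<forall>\<^sub>F x in at_right 0. x ^ k * (exp (-x) * x powr (\<alpha> + 1)) = x ^ k * (x * laguerre_w \<alpha> x)"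
      using eventually_at_right_less[of 0]
      by eventually_elim (simp add: laguerre_w_def powr_add)
    ultimately show "((\<lambda>x. x ^ k * (x * laguerre_w \<alpha> x)) \<longlongrightarrow> 0) (at_right 0)"
      by (simp add: filterlim_cong)
    show "((\<lambda>x. x ^ k * (x * laguerre_w \<alpha> x)) \<longlongrightarrow> 0) at_top"
      unfolding laguerre_w_def by real_asymp
  qed
  have "weight_functional (einterval (ereal 0) \<infinity>) (laguerre_w \<alpha>)
      ([:0, 1:] * pderiv p + [:complex_of_real (\<alpha> + 1), -1:] * p) = 0"
  proof (rule weight_functional_pearson[where \<phi> = "\<lambda>x. x" and \<psi> = "\<lambda>x. \<alpha> + 1 - x"])
    fix x assume "x \<in> einterval (ereal 0) \<infinity>"
    then have x: "0 < x" by simp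
    show "((\<lambda>x. x * laguerre_w \<alpha> x) has_real_derivative (\<alpha> + 1 - x) * laguerre_w \<alpha> x) (at x)"
      unfolding laguerre_w_def using x
      by - (rule derivative_eq_intros refl | simp add: algebra_simps powr_diff powr_minus_divide)+
    show "isCont (laguerre_w \<alpha>) x" unfolding laguerre_w_def using x by (auto intro!: continuous_intros)
  qed (use lim in \<open>auto simp: finite_moments_laguerre[OF \<alpha>] ereal_tendsto_simps\<close>)
  then show ?thesis by simp
qed

text \<open>The quotient of the weights is \<open>x powr (\<alpha> j - \<alpha> i)\<close>; were it
  rational, the exponent would be an order at 0, hence an integer.\<close>

lemma laguerre_incompatible:
  assumes "\<alpha> i > -1" "\<alpha> j > -1" "\<alpha> j - \<alpha> i \<notin> \<int>"
    and "\<And>p. weight_functional {0<..} (laguerre_w (\<alpha> j)) (u * p) = weight_functional {0<..} (laguerre_w (\<alpha> i)) (v * p)"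
  shows "u = 0"
proof (rule ccontr)
  assume u: "u \<noteq> 0"
  note pos = positive_laguerre[OF assms(1)] positive_laguerre[OF assms(2)]
  have v: "v \<noteq> 0"
    using weight_functional_eq_0[OF pos(2) assms(4) positive_functionalD(1)[OF pos(1)]] u by auto
  have "([:complex_of_real (\<alpha> j + 1), -1:] - [:complex_of_real (\<alpha> i + 1), -1:]) * (u * v)
      = [:0, 1:] * (pderiv v * u - pderiv u * v)"
    by (rule pearson_compatibility[OF pos pearson_laguerre[OF assms(1)] pearson_laguerre[OF assms(2)] assms(4)])
  then have "[:complex_of_real (\<alpha> j - \<alpha> i):] * (u * v) = [:- 0, 1:] * 1 * (pderiv v * u - pderiv u * v)"
    by simp
  from pearson_root_integer[OF this u v] obtain m :: int where "complex_of_real (\<alpha> j - \<alpha> i) = of_int m"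
    by auto
  then have "\<alpha> j - \<alpha> i = of_int m" by (metis of_real_eq_iff of_real_of_int_eq)
  then show False using assms(3) by simp
qed

section \<open>Jacobi weights\<close>

lemma finite_moments_jacobi:
  assumes "\<alpha> > -1" "\<beta> > -1"
  shows "finite_moments {-1<..<1} (jacobi_w \<alpha> \<beta>)"
  unfolding finite_moments_def
proof
  fix k :: nat
  have "set_integrable lborel {0<..<1} (\<lambda>t. t powr (\<beta> + 1 - 1) * (1 - t) powr (\<alpha> + 1 - 1))"
    by (rule set_integrable_of_has_integral[OF has_integral_Beta_real]) (use assms in auto)
  then have "integrable lborel (\<lambda>t. indicat_real {0<..<1} t * (t powr \<beta> * (1 - t) powr \<alpha>))"
    by (simp add: set_integrable_def)
  \<comment> \<open>The substitution t = (1 + x)/2 maps (-1,1) to (0,1); the factor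
    \<open>2 powr (\<alpha> + \<beta>)\<close> undoes the halving of 1 + x and 1 - x.\<close>
  from lborel_integrable_real_affine[OF this, of "1/2" "1/2"]
  have "integrable lborel (\<lambda>x. 2 powr (\<alpha> + \<beta>) * (indicat_real {0<..<1} (1/2 + 1/2 * x) *
      ((1/2 + 1/2 * x) powr \<beta> * (1 - (1/2 + 1/2 * x)) powr \<alpha>)))"
    by (intro integrable_mult_right) simp
  moreover have "2 powr (\<alpha> + \<beta>) * (indicat_real {0<..<1} (1/2 + 1/2 * x) *
      ((1/2 + 1/2 * x) powr \<beta> * (1 - (1/2 + 1/2 * x)) powr \<alpha>)) = indicat_real {-1<..<1} x * jacobi_w \<alpha> \<beta> x" for x
  proof (cases "x \<in> {-1<..<1}")
    case True
    then have "(1/2 + 1/2 * x) powr \<beta> = (1 + x) powr \<beta> / 2 powr \<beta>"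
      "(1 - (1/2 + 1/2 * x)) powr \<alpha> = (1 - x) powr \<alpha> / 2 powr \<alpha>"
      using powr_divide[of "1 + x" 2 \<beta>] powr_divide[of "1 - x" 2 \<alpha>] by (simp_all add: field_simps)
    then show ?thesis using True by (simp add: jacobi_w_def powr_add)
  qed (auto simp: indicator_def)
  ultimately have int: "integrable lborel (\<lambda>x. indicat_real {-1<..<1} x * jacobi_w \<alpha> \<beta> x)" by (simp only:)
  show "set_integrable lborel {-1<..<1} (\<lambda>x. x ^ k * jacobi_w \<alpha> \<beta> x)"
    unfolding set_integrable_def
  proof (rule Bochner_Integration.integrable_bound[OF int])
    show "(\<lambda>x. indicat_real {-1<..<1} x *\<^sub>R (x ^ k * jacobi_w \<alpha> \<beta> x)) \<in> borel_measurable lborel"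
      unfolding jacobi_w_def by measurable
    show "AE x in lborel. norm (indicat_real {-1<..<1} x *\<^sub>R (x ^ k * jacobi_w \<alpha> \<beta> x))
        \<le> norm (indicat_real {-1<..<1} x * jacobi_w \<alpha> \<beta> x)"
    proof (rule AE_I2)
      fix x :: real
      have "\<bar>x\<bar> ^ k * \<bar>jacobi_w \<alpha> \<beta> x\<bar> \<le> 1 * \<bar>jacobi_w \<alpha> \<beta> x\<bar>" if "x \<in> {-1<..<1}"
        using that by (intro mult_right_mono power_le_one) auto
      then show "norm (indicat_real {-1<..<1} x *\<^sub>R (x ^ k * jacobi_w \<alpha> \<beta> x))
          \<le> norm (indicat_real {-1<..<1} x * jacobi_w \<alpha> \<beta> x)"
        by (auto simp: indicator_def abs_mult power_abs)
    qed
  qed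
qed

lemma positive_jacobi:
  assumes "\<alpha> > -1" "\<beta> > -1"
  shows "positive_functional (weight_functional {-1<..<1} (jacobi_w \<alpha> \<beta>))"
  by (rule positive_weight_functional[OF finite_moments_jacobi[OF assms]]) (auto simp: jacobi_w_def)

lemma pearson_jacobi:
  assumes ab: "\<alpha> > -1" "\<beta> > -1"
  shows "weight_functional {-1<..<1} (jacobi_w \<alpha> \<beta>)
    ([:1, 0, -1:] * pderiv p + [:complex_of_real (\<beta> - \<alpha>), complex_of_real (- 2 - \<alpha> - \<beta>):] * p) = 0"
proof -
  \<comment> \<open>Merging \<open>1 - x\<^sup>2\<close> into the weight makes both exponents
    positive, so \<open>F k\<close> is continuous on the closed interval and vanishes at its
    ends.\<close>
  define F where "F k x = x ^ k * ((1 - x) powr (\<alpha> + 1) * (1 + x) powr (\<beta> + 1))" for k :: nat and x :: real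
  have F: "F k x = x ^ k * ((1 - x\<^sup>2) * jacobi_w \<alpha> \<beta> x)" if "-1 < x" "x < 1" for k x
    using that by (simp add: F_def jacobi_w_def powr_add power2_eq_square algebra_simps)
  have Fcont: "continuous_on {-1..1} (F k)" for k
    unfolding F_def using ab
    by (intro continuous_intros continuous_on_powr') auto
  have lim: "((\<lambda>x. x ^ k * ((1 - x\<^sup>2) * jacobi_w \<alpha> \<beta> x)) \<longlongrightarrow> 0) (at_right (-1))"
    "((\<lambda>x. x ^ k * ((1 - x\<^sup>2) * jacobi_w \<alpha> \<beta> x)) \<longlongrightarrow> 0) (at_left 1)" for k
  proof -
    have "(F k \<longlongrightarrow> F k (-1)) (at_right (-1))" "(F k \<longlongrightarrow> F k 1) (at_left 1)"
      using Fcont[of k] at_within_Icc_at_right[of "-1" "1::real"] at_within_Icc_at_left[of "-1" "1::real"]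
      by (auto simp: continuous_on_def dest: bspec[of _ _ 1] bspec[of _ _ "-1"])
    moreover have "\<forall>\<^sub>F x in at_right (-1). F k x = x ^ k * ((1 - x\<^sup>2) * jacobi_w \<alpha> \<beta> x)"
      using eventually_at_right_real[of "-1" "1::real"] by (auto elim!: eventually_mono simp: F)
    moreover have "\<forall>\<^sub>F x in at_left 1. F k x = x ^ k * ((1 - x\<^sup>2) * jacobi_w \<alpha> \<beta> x)"
      using eventually_at_left_real[of "-1" "1::real"] by (auto elim!: eventually_mono simp: F)
    moreover have "F k 1 = 0" "F k (-1) = 0" using ab by (auto simp: F_def)
    ultimately show "((\<lambda>x. x ^ k * ((1 - x\<^sup>2) * jacobi_w \<alpha> \<beta> x)) \<longlongrightarrow> 0) (at_right (-1))"
      "((\<lambda>x. x ^ k * ((1 - x\<^sup>2) * jacobi_w \<alpha> \<beta> x)) \<longlongrightarrow> 0) (at_left 1)"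
      by (simp_all add: filterlim_cong)
  qed
  have "weight_functional (einterval (ereal (-1)) (ereal 1)) (jacobi_w \<alpha> \<beta>)
    ([:1, 0, -1:] * pderiv p + [:complex_of_real (\<beta> - \<alpha>), complex_of_real (- 2 - \<alpha> - \<beta>):] * p) = 0"
  proof (rule weight_functional_pearson[where \<phi> = "\<lambda>x. 1 - x\<^sup>2" and \<psi> = "\<lambda>x. \<beta> - \<alpha> + (- 2 - \<alpha> - \<beta>) * x"])
    fix x assume "x \<in> einterval (ereal (-1)) (ereal 1)"
    then have x: "-1 < x" "x < 1" by auto
    show "((\<lambda>x. (1 - x\<^sup>2) * jacobi_w \<alpha> \<beta> x) has_real_derivative
        (\<beta> - \<alpha> + (- 2 - \<alpha> - \<beta>) * x) * jacobi_w \<alpha> \<beta> x) (at x)"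
    proof -
      have "((\<lambda>x. (1 - x\<^sup>2) * jacobi_w \<alpha> \<beta> x) has_real_derivative
        - 2 * x * jacobi_w \<alpha> \<beta> x + (1 - x\<^sup>2) * (- \<alpha> * (1 - x) powr (\<alpha> - 1) * (1 + x) powr \<beta>
           + (1 - x) powr \<alpha> * (\<beta> * (1 + x) powr (\<beta> - 1)))) (at x)"
        unfolding jacobi_w_def using x
        by - (rule derivative_eq_intros refl | simp)+
      also have "- 2 * x * jacobi_w \<alpha> \<beta> x + (1 - x\<^sup>2) * (- \<alpha> * (1 - x) powr (\<alpha> - 1) * (1 + x) powr \<beta>
           + (1 - x) powr \<alpha> * (\<beta> * (1 + x) powr (\<beta> - 1)))
          = (\<beta> - \<alpha> + (- 2 - \<alpha> - \<beta>) * x) * jacobi_w \<alpha> \<beta> x"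
      proof -
        have "(1 - x\<^sup>2) * (1 - x) powr (\<alpha> - 1) = (1 + x) * (1 - x) powr \<alpha>"
          "(1 - x\<^sup>2) * (1 + x) powr (\<beta> - 1) = (1 - x) * (1 + x) powr \<beta>"
          using x by (simp_all add: powr_diff field_simps power2_eq_square)
        moreover have "- 2 * x * jacobi_w \<alpha> \<beta> x + (1 - x\<^sup>2) * (- \<alpha> * (1 - x) powr (\<alpha> - 1) * (1 + x) powr \<beta>
           + (1 - x) powr \<alpha> * (\<beta> * (1 + x) powr (\<beta> - 1)))
          = - 2 * x * jacobi_w \<alpha> \<beta> x - \<alpha> * ((1 - x\<^sup>2) * (1 - x) powr (\<alpha> - 1)) * (1 + x) powr \<beta>
           + \<beta> * (1 - x) powr \<alpha> * ((1 - x\<^sup>2) * (1 + x) powr (\<beta> - 1))"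
          by (simp add: algebra_simps)
        ultimately show ?thesis by (simp only:) (simp add: jacobi_w_def algebra_simps)
      qed
      finally show ?thesis .
    qed
    show "isCont (jacobi_w \<alpha> \<beta>) x" unfolding jacobi_w_def using x by (auto intro!: continuous_intros)
  qed (use lim in \<open>auto simp: finite_moments_jacobi[OF ab] ereal_tendsto_simps power2_eq_square mult.commute\<close>)
  then show ?thesis by simp
qed

text \<open>The logarithmic derivative of the quotient of the weights has residues
  \<open>\<alpha> j - \<alpha> i\<close> at 1 and \<open>\<beta> j - \<beta> i\<close> at -1. A
  rational quotient makes both integers, so one nonintegral difference is enough.\<close>

lemma jacobi_incompatible:
  assumes ab: "\<alpha> i > -1" "\<beta> i > -1" "\<alpha> j > -1" "\<beta> j > -1"
    and nonint: "\<alpha> j - \<alpha> i \<notin> \<int> \<or> \<beta> j - \<beta> i \<notin> \<int>"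
    and eq: "\<And>p. weight_functional {-1<..<1} (jacobi_w (\<alpha> j) (\<beta> j)) (u * p)
      = weight_functional {-1<..<1} (jacobi_w (\<alpha> i) (\<beta> i)) (v * p)"
  shows "u = 0"
proof (rule ccontr)
  assume u: "u \<noteq> 0"
  note pos = positive_jacobi[OF ab(1,2)] positive_jacobi[OF ab(3,4)]
  have v: "v \<noteq> 0"
    using weight_functional_eq_0[OF pos(2) eq positive_functionalD(1)[OF pos(1)]] u by auto
  define h where "h = [:complex_of_real (\<beta> j - \<alpha> j), complex_of_real (- 2 - \<alpha> j - \<beta> j):]
    - [:complex_of_real (\<beta> i - \<alpha> i), complex_of_real (- 2 - \<alpha> i - \<beta> i):]"
  have h: "h * (u * v) = [:1, 0, -1:] * (pderiv v * u - pderiv u * v)"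
    unfolding h_def
    by (rule pearson_compatibility[OF pos pearson_jacobi[OF ab(1,2)] pearson_jacobi[OF ab(3,4)] eq])
  have "[:1, 0, -1:] = [:- (1::complex), 1:] * [:-1, -1:]" by simp
  then have 1: "h * (u * v) = [:- 1, 1:] * [:-1, -1:] * (pderiv v * u - pderiv u * v)"
    using h by simp
  obtain m :: int where "poly h 1 = poly [:-1, -1:] 1 * of_int m"
    using pearson_root_integer[OF 1 u v] by blast
  then have "2 * complex_of_real (\<alpha> j - \<alpha> i) = 2 * of_int m"
    by (simp add: h_def algebra_simps)
  then have "complex_of_real (\<alpha> j - \<alpha> i) = of_int m" by (simp only: mult_cancel_left) simp
  then have "\<alpha> j - \<alpha> i = of_int m" by (metis of_real_eq_iff of_real_of_int_eq)
  moreover have "[:1, 0, -1:] = [:- (-1::complex), 1:] * [:1, -1:]" by simp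
  then have 2: "h * (u * v) = [:- (- 1), 1:] * [:1, -1:] * (pderiv v * u - pderiv u * v)"
    using h by simp
  obtain m' :: int where "poly h (-1) = poly [:1, -1:] (-1) * of_int m'"
    using pearson_root_integer[OF 2 u v] by blast
  then have "2 * complex_of_real (\<beta> j - \<beta> i) = 2 * of_int m'"
    by (simp add: h_def algebra_simps)
  then have "complex_of_real (\<beta> j - \<beta> i) = of_int m'" by (simp only: mult_cancel_left) simp
  then have "\<beta> j - \<beta> i = of_int m'" by (metis of_real_eq_iff of_real_of_int_eq)
  ultimately show False using nonint by simp
qed

section \<open>Matrix polynomials\<close>

lemma mult_mat_entry:
  assumes "A \<in> carrier_mat N N" "B \<in> carrier_mat N N" "i < N" "j < N"
  shows "(A * B) $$ (i,j) = (\<Sum>k<N. A $$ (i,k) * B $$ (k,j))"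
  using assms by (simp add: scalar_prod_def lessThan_atLeast0)

lemma peval_carrier: "P \<in> carrier_mat N N \<Longrightarrow> peval P z \<in> carrier_mat N N"
  by (simp add: peval_def)

lemma peval_entry: "P \<in> carrier_mat N N \<Longrightarrow> r < N \<Longrightarrow> c < N \<Longrightarrow> peval P z $$ (r,c) = poly (P $$ (r,c)) z"
  by (simp add: peval_def)

lemma det_peval: "Determinant.det (peval F z) = poly (Determinant.det F) z"
proof -
  interpret h: comm_ring_hom "\<lambda>p. poly p z" by unfold_locales simp_all
  show ?thesis unfolding peval_def by (rule h.hom_det)
qed

lemma adj_peval_entry:
  assumes "F \<in> carrier_mat N N" "r < N" "c < N"
  shows "adj_mat (peval F z) $$ (r,c) = poly (adj_mat F $$ (r,c)) z"
proof -
  have "mat_delete (peval F z) c r = peval (mat_delete F c r) z"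
    using assms by (intro eq_matI) (auto simp: mat_delete_def peval_def)
  then show ?thesis
    using assms by (simp add: adj_mat_def cofactor_def det_peval peval_carrier[THEN carrier_matD(1)]
        peval_carrier[THEN carrier_matD(2)])
qed

text \<open>Cramer's rule. At zeros of the determinant both sides are 0, division by zero being 0,
  so the formula is an identity of functions and may be differentiated.\<close>

lemma minv_peval:
  assumes "F \<in> carrier_mat N N"
  shows "minv (peval F z) \<in> carrier_mat N N"
    and "r < N \<Longrightarrow> c < N \<Longrightarrow> minv (peval F z) $$ (r,c) = poly (adj_mat F $$ (r,c)) z / poly (Determinant.det F) z"
proof -
  have "adj_mat (peval F z) \<in> carrier_mat N N" by (intro adj_mat peval_carrier assms)
  then show "minv (peval F z) \<in> carrier_mat N N"
    and "r < N \<Longrightarrow> c < N \<Longrightarrow> minv (peval F z) $$ (r,c) = poly (adj_mat F $$ (r,c)) z / poly (Determinant.det F) z"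
    using assms by (simp_all add: minv_def det_peval flip: adj_peval_entry)
qed

lemma poly_eq_off_roots:
  fixes p q d :: "complex poly"
  assumes "d \<noteq> 0" "\<And>z. poly d z \<noteq> 0 \<Longrightarrow> poly p z = poly q z"
  shows "p = q"
proof -
  have "poly (d * (p - q)) z = 0" for z using assms(2)[of z] by (cases "poly d z = 0") auto
  then have "d * (p - q) = 0" using poly_all_0_iff_0 by blast
  then show ?thesis using assms(1) by simp
qed

text \<open>By spanning and linearity, divisibility on the rows \<open>Q n k\<close> extends to all
  rows, in particular to \<open>p\<close> placed in position \<open>r\<close>. This turns quotients
  by a determinant into operators on polynomials.\<close>

lemma monic_family_dvd:
  assumes Q: "monic_family N Q" and M: "\<And>r. r < N \<Longrightarrow> linear_op (M r)"
    and dvd: "\<And>n k. k < N \<Longrightarrow> e dvd (\<Sum>r<N. M r (Q n k r))" and r: "r < N"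
  shows "e dvd M r p"
proof -
  define q where "q s = (if s = r then p else 0)" for s
  obtain K where "\<forall>s<N. deg_below K (q s)" using ex_deg_below by blast
  then obtain c where c: "\<forall>s<N. q s = (\<Sum>n<K. \<Sum>k<N. smult (c n k) (Q n k s))"
    using monic_family_span[OF Q] by blast
  have "M r p = (\<Sum>s<N. if s = r then M s p else 0)" using r by simp
  also have "\<dots> = (\<Sum>s<N. M s (q s))"
    using M by (intro sum.cong) (auto simp: q_def linear_opD)
  also have "\<dots> = (\<Sum>s<N. \<Sum>n<K. \<Sum>k<N. smult (c n k) (M s (Q n k s)))"
    using c M by (intro sum.cong) (auto simp: linear_opD)
  also have "\<dots> = (\<Sum>n<K. \<Sum>s<N. \<Sum>k<N. smult (c n k) (M s (Q n k s)))"
    by (rule sum.swap)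
  also have "\<dots> = (\<Sum>n<K. \<Sum>k<N. smult (c n k) (\<Sum>s<N. M s (Q n k s)))"
    unfolding smult_sum_right by (rule sum.cong[OF refl]) (rule sum.swap)
  also have "e dvd \<dots>"
    by (rule dvd_sum, rule dvd_sum, rule dvd_smult, rule dvd) simp
  finally show ?thesis .
qed

lemma finite_order_exact_div:
  assumes "finite_order M" "\<And>p. d dvd M p" "d \<noteq> 0"
  shows "finite_order (\<lambda>p. M p div d)"
proof (rule finite_order_cancel[OF _ assms(3)])
  have "(\<lambda>p. d * (M p div d)) = M" using assms(2) by (simp add: fun_eq_iff)
  then show "finite_order (\<lambda>p. d * (M p div d))" using assms(1) by simp
qed

text \<open>The numerator of the j-th derivative of \<open>p / d\<close> over the denominator
  \<open>d ^ Suc j\<close>, as the quotient rule gives it.\<close>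

primrec quot_numer :: "complex poly \<Rightarrow> nat \<Rightarrow> complex poly \<Rightarrow> complex poly" where
  "quot_numer d 0 p = p"
| "quot_numer d (Suc j) p = pderiv (quot_numer d j p) * d - quot_numer d j p * (of_nat (Suc j) * pderiv d)"

lemma finite_order_quot_numer: "finite_order B \<Longrightarrow> finite_order (\<lambda>p. quot_numer d j (B p))"
  by (induction j) (simp_all only: quot_numer.simps finite_order_minus finite_order_mult finite_order_pderiv)

lemma higher_deriv_quotient:
  assumes "poly d z \<noteq> 0"
  shows "(deriv ^^ j) (\<lambda>w. poly p w / poly d w) z = poly (quot_numer d j p) z / poly d z ^ Suc j"
  using assms
proof (induction j arbitrary: z)
  case (Suc j)
  let ?q = "quot_numer d j p"
  \<comment> \<open>To be differentiated, the induction hypothesis must hold on a neighbourhood of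
    \<open>z\<close>, where \<open>d\<close> stays nonzero.\<close>
  have "open {w. poly d w \<noteq> 0}" by (intro open_Collect_neq continuous_intros)
  then have "\<forall>\<^sub>F w in nhds z. poly d w \<noteq> 0" using Suc.prems by (simp add: eventually_nhds) blast
  then have "\<forall>\<^sub>F w in nhds z. (deriv ^^ j) (\<lambda>w. poly p w / poly d w) w = poly ?q w / poly d w ^ Suc j"
    by eventually_elim (rule Suc.IH)
  then have "(deriv ^^ Suc j) (\<lambda>w. poly p w / poly d w) z = deriv (\<lambda>w. poly ?q w / poly d w ^ Suc j) z"
    by (simp add: deriv_cong_ev)
  also have "\<dots> = poly (quot_numer d (Suc j) p) z / poly d z ^ Suc (Suc j)"
  proof (rule DERIV_imp_deriv)
    have "((\<lambda>w. poly ?q w / poly d w ^ Suc j) has_field_derivative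
      (poly (pderiv ?q) z * poly d z ^ Suc j - poly ?q z * (of_nat (Suc j) * (poly (pderiv d) z * poly d z ^ j)))
        / (poly d z ^ Suc j * poly d z ^ Suc j)) (at z)"
      using Suc.prems
      by (intro DERIV_divide poly_DERIV DERIV_cong[OF DERIV_power_Suc[OF poly_DERIV]]) simp_all
    moreover have "(poly (pderiv ?q) z * poly d z ^ Suc j - poly ?q z * (of_nat (Suc j) * (poly (pderiv d) z * poly d z ^ j)))
        / (poly d z ^ Suc j * poly d z ^ Suc j) = poly (quot_numer d (Suc j) p) z / poly d z ^ Suc (Suc j)"
    proof -
      have "poly (pderiv ?q) z * poly d z ^ Suc j - poly ?q z * (of_nat (Suc j) * (poly (pderiv d) z * poly d z ^ j))
        = poly d z ^ j * poly (quot_numer d (Suc j) p) z"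
        by (simp add: algebra_simps)
      then show ?thesis using Suc.prems by (simp add: field_simps)
    qed
    ultimately show "((\<lambda>w. poly ?q w / poly d w ^ Suc j) has_field_derivative
      poly (quot_numer d (Suc j) p) z / poly d z ^ Suc (Suc j)) (at z)" by simp
  qed
  finally show ?case .
qed simp

lemma funpow_mpderiv: "(mpderiv ^^ j) P = map_mat (pderiv ^^ j) P"
  by (induction j) (auto simp: mpderiv_def intro!: eq_matI)

section \<open>Matrix orthogonal polynomials as rows\<close>

lemma monic_OPs_family:
  assumes "monic_OPs N S W P"
  shows "P n \<in> carrier_mat N N" "monic_family N (\<lambda>n r c. P n $$ (r,c))"
proof -
  have m: "monic_deg N (P n) n" for n using assms by (simp add: monic_OPs_def)
  then show P: "P n \<in> carrier_mat N N" for n by (simp add: monic_deg_def)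
  have c: "coeff (P n $$ (r,c)) k = mcoeff (P n) k $$ (r,c)" if "r < N" "c < N" for n k r c
    using P[of n] that by (simp add: mcoeff_def)
  show "monic_family N (\<lambda>n r c. P n $$ (r,c))"
    using m unfolding monic_family_def deg_below_def monic_deg_def by (auto simp: c)
qed

text \<open>The entrywise form of
  \<open>p (t diag(w) t\<^sup>T) q = (p t) diag(w) (t\<^sup>T q)\<close>.\<close>

lemma sum_triple_rearrange:
  fixes p q w :: "nat \<Rightarrow> 'a::comm_ring_1"
  shows "(\<Sum>l<N. (\<Sum>k<N. p k * (\<Sum>s<N. t k s * w s * t l s)) * q l)
    = (\<Sum>s<N. (\<Sum>k<N. p k * t k s) * (\<Sum>l<N. t l s * q l) * w s)"
proof -
  have "(\<Sum>k<N. p k * (\<Sum>s<N. t k s * w s * t l s)) = (\<Sum>s<N. (\<Sum>k<N. p k * t k s) * w s * t l s)" for l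
    unfolding sum_distrib_left sum_distrib_right by (subst sum.swap) (simp add: mult.assoc)
  then have "(\<Sum>l<N. (\<Sum>k<N. p k * (\<Sum>s<N. t k s * w s * t l s)) * q l)
      = (\<Sum>l<N. \<Sum>s<N. (\<Sum>k<N. p k * t k s) * w s * t l s * q l)"
    by (simp add: sum_distrib_right)
  also have "\<dots> = (\<Sum>s<N. \<Sum>l<N. (\<Sum>k<N. p k * t k s) * w s * t l s * q l)"
    by (rule sum.swap)
  also have "\<dots> = (\<Sum>s<N. (\<Sum>k<N. p k * t k s) * (\<Sum>l<N. t l s * q l) * w s)"
  proof (rule sum.cong[OF refl])
    fix s
    have "(\<Sum>k<N. p k * t k s) * (\<Sum>l<N. t l s * q l) * w s
        = (\<Sum>k<N. p k * t k s) * w s * (\<Sum>l<N. t l s * q l)" by (simp only: mult_ac)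
    then show "(\<Sum>l<N. (\<Sum>k<N. p k * t k s) * w s * t l s * q l)
        = (\<Sum>k<N. p k * t k s) * (\<Sum>l<N. t l s * q l) * w s"
      unfolding sum_distrib_left[of "(\<Sum>k<N. p k * t k s) * w s"] by (simp only: mult.assoc)
  qed
  finally show ?thesis .
qed

lemma ip_entry:
  assumes P: "P \<in> carrier_mat N N" and Q: "Q \<in> carrier_mat N N" and rc: "r < N" "c < N"
    and W: "\<And>x. W x \<in> carrier_mat N N"
      "\<And>x r c. r < N \<Longrightarrow> c < N \<Longrightarrow> W x $$ (r,c) = (\<Sum>s<N. t r s x * w s x * t c s x)"
    and T: "\<And>r s x. r < N \<Longrightarrow> s < N \<Longrightarrow> poly (T r s) (complex_of_real x) = complex_of_real (t r s x)"
    and mom: "\<And>s. s < N \<Longrightarrow> finite_moments S (w s)"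
  shows "ip N S W P Q $$ (r,c) = (\<Sum>s<N. weight_functional S (w s)
    ((\<Sum>k<N. P $$ (r,k) * T k s) * map_poly cnj (\<Sum>k<N. Q $$ (c,k) * T k s)))"
proof -
  let ?p = "\<lambda>s. (\<Sum>k<N. P $$ (r,k) * T k s) * map_poly cnj (\<Sum>k<N. Q $$ (c,k) * T k s)"
  have eq: "(peval P (complex_of_real x) * map_mat complex_of_real (W x) * cadj N (peval Q (complex_of_real x))) $$ (r,c)
     = (\<Sum>s<N. poly (?p s) (complex_of_real x) * complex_of_real (w s x))" for x
  proof -
    let ?x = "complex_of_real x"
    let ?W = "map_mat complex_of_real (W x)" and ?t = "\<lambda>k s. complex_of_real (t k s x)"
    have cP: "peval P ?x \<in> carrier_mat N N" and cW: "?W \<in> carrier_mat N N"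
      and cQ: "cadj N (peval Q ?x) \<in> carrier_mat N N"
      using P W(1) by (simp_all add: peval_carrier cadj_def)
    have Wc: "?W $$ (k,l) = (\<Sum>s<N. ?t k s * complex_of_real (w s x) * ?t l s)" if "k < N" "l < N" for k l
      using that carrier_matD[OF W(1)[of x]] by (simp add: W(2))
    have Qc: "cadj N (peval Q ?x) $$ (l,c) = cnj (poly (Q $$ (c,l)) ?x)" if "l < N" for l
      using that rc by (simp add: cadj_def peval_entry[OF Q])
    have row: "(peval P ?x * ?W) $$ (r,l) = (\<Sum>k<N. poly (P $$ (r,k)) ?x * (\<Sum>s<N. ?t k s * complex_of_real (w s x) * ?t l s))"
      if "l < N" for l
      unfolding mult_mat_entry[OF cP cW rc(1) that]
    proof (rule sum.cong[OF refl])
      fix k assume "k \<in> {..<N}"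
      then have k: "k < N" by simp
      show "peval P ?x $$ (r,k) * ?W $$ (k,l) = poly (P $$ (r,k)) ?x * (\<Sum>s<N. ?t k s * complex_of_real (w s x) * ?t l s)"
        unfolding Wc[OF k that] peval_entry[OF P rc(1) k] ..
    qed
    have "(peval P ?x * ?W * cadj N (peval Q ?x)) $$ (r,c)
        = (\<Sum>l<N. (\<Sum>k<N. poly (P $$ (r,k)) ?x * (\<Sum>s<N. ?t k s * complex_of_real (w s x) * ?t l s)) * cnj (poly (Q $$ (c,l)) ?x))"
      unfolding mult_mat_entry[OF mult_carrier_mat[OF cP cW] cQ rc]
    proof (rule sum.cong[OF refl])
      fix l assume "l \<in> {..<N}"
      then have l: "l < N" by simp
      show "(peval P ?x * ?W) $$ (r,l) * cadj N (peval Q ?x) $$ (l,c)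
        = (\<Sum>k<N. poly (P $$ (r,k)) ?x * (\<Sum>s<N. ?t k s * complex_of_real (w s x) * ?t l s)) * cnj (poly (Q $$ (c,l)) ?x)"
        unfolding row[OF l] Qc[OF l] ..
    qed
    also have "\<dots> = (\<Sum>s<N. (\<Sum>k<N. poly (P $$ (r,k)) ?x * ?t k s) * (\<Sum>l<N. ?t l s * cnj (poly (Q $$ (c,l)) ?x)) * complex_of_real (w s x))"
      by (rule sum_triple_rearrange)
    also have "\<dots> = (\<Sum>s<N. poly (?p s) ?x * complex_of_real (w s x))"
      by (intro sum.cong refl) (simp add: poly_sum T mult.commute)
    finally show ?thesis .
  qed
  have "ip N S W P Q $$ (r,c) = (LINT x:S|lborel. \<Sum>s<N. poly (?p s) (complex_of_real x) * complex_of_real (w s x))"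
    using rc by (simp add: ip_def eq)
  also have "\<dots> = (\<Sum>s<N. weight_functional S (w s) (?p s))"
    unfolding weight_functional_def set_lebesgue_integral_def scaleR_sum_right
    by (rule Bochner_Integration.integral_sum)
      (use set_integrable_poly_weight[OF mom] in \<open>unfold set_integrable_def, blast\<close>)
  finally show ?thesis .
qed

lemma orthogonal_rows_of_monic_OPs:
  assumes P: "monic_OPs N S W P"
    and W: "\<And>x. W x \<in> carrier_mat N N"
      "\<And>x r c. r < N \<Longrightarrow> c < N \<Longrightarrow> W x $$ (r,c) = (\<Sum>s<N. t r s x * w s x * t c s x)"
    and T: "\<And>r s x. r < N \<Longrightarrow> s < N \<Longrightarrow> poly (T r s) (complex_of_real x) = complex_of_real (t r s x)"
      "\<And>r c. r < N \<Longrightarrow> c < N \<Longrightarrow> (\<Sum>s<N. T r s * Ti s c) = (if r = c then 1 else 0)"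
      "\<And>r c. r < N \<Longrightarrow> c < N \<Longrightarrow> (\<Sum>s<N. Ti r s * T s c) = (if r = c then 1 else 0)"
      "\<And>r c. r < N \<Longrightarrow> c < N \<Longrightarrow> deg_below 2 (T r c)"
      "\<And>r c. r < N \<Longrightarrow> c < N \<Longrightarrow> deg_below 2 (Ti r c)"
      "\<And>r c. r < N \<Longrightarrow> c < N \<Longrightarrow> map_poly cnj (T r c) = T r c"
    and w: "\<And>s. s < N \<Longrightarrow> finite_moments S (w s)"
      "\<And>s. s < N \<Longrightarrow> positive_functional (weight_functional S (w s))"
  shows "orthogonal_rows N (\<lambda>s. weight_functional S (w s)) T Ti (\<lambda>n r c. P n $$ (r,c))"
proof
  fix n m k k' :: nat assume nm: "n \<noteq> m" and k: "k < N" "k' < N"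
  have "(\<Sum>s<N. weight_functional S (w s) ((\<Sum>r<N. P n $$ (k,r) * T r s) * map_poly cnj (\<Sum>r<N. P m $$ (k',r) * T r s)))
      = ip N S W (P n) (P m) $$ (k,k')"
    by (rule ip_entry[symmetric, OF monic_OPs_family(1)[OF P] monic_OPs_family(1)[OF P] k W T(1) w(1)])
  also have "\<dots> = 0" using P nm k by (simp add: monic_OPs_def)
  finally show "(\<Sum>s<N. weight_functional S (w s) ((\<Sum>r<N. P n $$ (k,r) * T r s) * map_poly cnj (\<Sum>r<N. P m $$ (k',r) * T r s))) = 0" .
qed (assumption | rule T w monic_OPs_family(2)[OF P])+

text \<open>Off the diagonal the entry has degree below \<open>n\<close>, so its own conjugate,
  placed in coordinate \<open>c\<close>, is an admissible test row; orthogonality gives it norm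
  zero.\<close>

lemma direct_sum_OPs_diagonal:
  assumes w: "\<forall>i<N. scalar_weight S (w i)" and P: "monic_OPs N S (direct_sum N w) P"
    and rc: "r < N" "c < N" "r \<noteq> c"
  shows "P n $$ (r,c) = 0"
proof -
  let ?\<delta> = "\<lambda>r c. if r = c then 1 else 0 :: complex poly"
  have mom: "finite_moments S (w s)" if "s < N" for s
    using w that by (simp add: scalar_weight_def finite_moments_def)
  have pos: "positive_functional (weight_functional S (w s))" if "s < N" for s
    using w that by (intro positive_weight_functional mom) (auto simp: scalar_weight_def)
  interpret orthogonal_rows N "\<lambda>s. weight_functional S (w s)" ?\<delta> ?\<delta> "\<lambda>n r c. P n $$ (r,c)"
  proof (rule orthogonal_rows_of_monic_OPs[OF P, where t = "\<lambda>r s x. if r = s then 1 else 0"])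
    show "direct_sum N w x \<in> carrier_mat N N" for x by (simp add: direct_sum_def)
    show "direct_sum N w x $$ (r,c) = (\<Sum>s<N. (if r = s then 1 else 0) * w s x * (if c = s then 1 else 0))"
      if "r < N" "c < N" for x r c
    proof -
      have "(\<Sum>s<N. (if r = s then 1 else 0) * w s x * (if c = s then 1 else 0))
          = (\<Sum>s<N. if s = r then (if r = c then w r x else 0) else 0)"
        by (intro sum.cong) auto
      then show ?thesis using that by (simp add: direct_sum_def)
    qed
  qed (auto simp: mom pos sum_delta_mult deg_below_def)
  define q where "q s = (if s = c then map_poly cnj (P n $$ (r,c)) else 0)" for s
  have "deg_below (Suc n) (P n $$ (r,c))" "coeff (P n $$ (r,c)) n = 0"
    using monic rc by (auto simp: monic_family_def)
  then have "deg_below n (P n $$ (r,c))" by (metis deg_below_def le_antisym not_less_eq_eq)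
  then have "form (\<lambda>c. P n $$ (r,c)) q = 0"
    using rc by (intro form_orth_below) (auto simp: q_def deg_below_cnj)
  moreover have "rowT p s = p s" if "s < N" for p s
    using that by (simp add: rowT_def sum_delta_mult)
  then have "form (\<lambda>c. P n $$ (r,c)) q = (\<Sum>s<N. if s = c then
      weight_functional S (w s) (P n $$ (r,c) * map_poly cnj (P n $$ (r,c))) else 0)"
    unfolding form_def by (intro sum.cong) (auto simp: q_def L_lin)
  ultimately have "weight_functional S (w c) (P n $$ (r,c) * map_poly cnj (P n $$ (r,c))) = 0"
    using rc by simp
  then show ?thesis using positive_functionalD(3)[OF pos[OF rc(2)]] by simp
qed

section \<open>Darboux transformations\<close>

lemma op_apply_diagonal_entry:
  assumes "P \<in> carrier_mat N N" "\<And>k. k < N \<Longrightarrow> k \<noteq> i \<Longrightarrow> P $$ (i,k) = 0"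
    and "\<forall>F\<in>set D. F \<in> carrier_mat N N" "i < N" "s < N"
  shows "op_apply N P D $$ (i,s) = (\<Sum>j<length D. (pderiv ^^ j) (P $$ (i,i)) * (D ! j) $$ (i,s))"
proof -
  have d0: "(pderiv ^^ j) 0 = (0 :: complex poly)" for j by (induction j) simp_all
  have "((mpderiv ^^ j) P * D ! j) $$ (i,s) = (pderiv ^^ j) (P $$ (i,i)) * (D ! j) $$ (i,s)"
    if "j < length D" for j
  proof -
    have "D ! j \<in> carrier_mat N N" using assms(3) that by auto
    then have "((mpderiv ^^ j) P * D ! j) $$ (i,s)
        = (\<Sum>k<N. map_mat (pderiv ^^ j) P $$ (i,k) * (D ! j) $$ (k,s))"
      unfolding funpow_mpderiv using assms by (intro mult_mat_entry) auto
    also have "\<dots> = (\<Sum>k<N. if k = i then (pderiv ^^ j) (P $$ (i,i)) * (D ! j) $$ (i,s) else 0)"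
      using assms by (intro sum.cong) (auto simp: d0)
    finally show ?thesis using assms by simp
  qed
  then show ?thesis using assms(4,5) by (simp add: op_apply_def)
qed

text \<open>Row \<open>i\<close> of the diagonal \<open>P n\<close> has one entry, so row
  \<open>i\<close> of the first Darboux relation consists of scalar operators applied to a single
  scalar polynomial.\<close>

lemma darboux_left_factor:
  assumes P: "\<And>n. P n \<in> carrier_mat N N" "monic_family N (\<lambda>n r c. P n $$ (r,c))"
    and diag: "\<And>n r c. r < N \<Longrightarrow> c < N \<Longrightarrow> r \<noteq> c \<Longrightarrow> P n $$ (r,c) = 0"
    and Q: "\<And>n. Q n \<in> carrier_mat N N"
    and D: "\<forall>F\<in>set D. F \<in> carrier_mat N N" and F: "F \<in> carrier_mat N N" "Determinant.det F \<noteq> 0"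
    and C: "\<And>n. C n \<in> carrier_mat N N"
    and eq: "\<And>n z. Determinant.det (peval F z) \<noteq> 0 \<Longrightarrow>
      C n * peval (Q n) z = peval (op_apply N (P n) D) z * minv (peval F z)"
    and i: "i < N"
  shows "\<exists>Z. \<forall>c<N. finite_order (Z c) \<and>
    (\<forall>n. Z c (P n $$ (i,i)) = (\<Sum>k<N. smult (C n $$ (i,k)) (Q n $$ (k,c))))"
proof -
  let ?d = "Determinant.det F"
  \<comment> \<open>The inverse is adjugate over determinant, and \<open>num c\<close> is the
    numerator; the quotient by \<open>?d\<close> is formed once divisibility is known.\<close>
  define num where "num c p = (\<Sum>s<N. (\<Sum>j<length D. (pderiv ^^ j) p * (D ! j) $$ (i,s)) * adj_mat F $$ (s,c))" for c p
  have num_fin: "finite_order (num c)" for c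
    unfolding num_def by (intro finite_order_sum finite_order_mult finite_order_funpow_pderiv)
  have num_P: "num c (P n $$ (i,i)) = ?d * (\<Sum>k<N. smult (C n $$ (i,k)) (Q n $$ (k,c)))" if c: "c < N" for n c
  proof (rule poly_eq_off_roots[OF F(2)])
    fix z assume z: "poly ?d z \<noteq> 0"
    let ?op = "op_apply N (P n) D"
    have op: "?op \<in> carrier_mat N N" by (simp add: op_apply_def)
    have op_s: "?op $$ (i,s) = (\<Sum>j<length D. (pderiv ^^ j) (P n $$ (i,i)) * (D ! j) $$ (i,s))" if "s < N" for s
      using P(1) diag D i that by (intro op_apply_diagonal_entry) auto
    have "(\<Sum>k<N. C n $$ (i,k) * poly (Q n $$ (k,c)) z) = (C n * peval (Q n) z) $$ (i,c)"
      using i c by (simp add: mult_mat_entry[OF C peval_carrier[OF Q]] peval_entry[OF Q])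
    also have "\<dots> = (peval ?op z * minv (peval F z)) $$ (i,c)"
      using eq[of z n] z by (simp add: det_peval)
    also have "\<dots> = (\<Sum>s<N. poly (?op $$ (i,s)) z * (poly (adj_mat F $$ (s,c)) z / poly ?d z))"
      using i c by (simp add: mult_mat_entry[OF peval_carrier[OF op] minv_peval(1)[OF F(1)]]
          peval_entry[OF op] minv_peval(2)[OF F(1)])
    also have "\<dots> = poly (num c (P n $$ (i,i))) z / poly ?d z"
      by (simp add: num_def poly_sum op_s sum_divide_distrib)
    finally show "poly (num c (P n $$ (i,i))) z = poly (?d * (\<Sum>k<N. smult (C n $$ (i,k)) (Q n $$ (k,c)))) z"
      using z by (simp add: poly_sum field_simps)
  qed
  \<comment> \<open>The diagonal entries are a monic scalar sequence, viewed as a family of size 1,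
    and so span all polynomials.\<close>
  have fam: "monic_family 1 (\<lambda>n r c. P n $$ (i,i))"
    using P(2) i by (simp add: monic_family_def)
  have dvd: "?d dvd num c p" if "c < N" for c p
    using monic_family_dvd[OF fam, of "\<lambda>_. num c" ?d 0 p] finite_order_linear[OF num_fin] num_P[OF that]
    by simp
  show ?thesis
  proof (intro exI[of _ "\<lambda>c p. num c p div ?d"] allI impI conjI)
    fix c n assume c: "c < N"
    show "finite_order (\<lambda>p. num c p div ?d)"
      by (rule finite_order_exact_div[OF num_fin dvd[OF c] F(2)])
    show "num c (P n $$ (i,i)) div ?d = (\<Sum>k<N. smult (C n $$ (i,k)) (Q n $$ (k,c)))"
      unfolding num_P[OF c] using F(2) by simp
  qed
qed

text \<open>The mirror image: column \<open>i\<close> of the second relation, where diagonality of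
  \<open>P n\<close> leaves one scalar polynomial. Here the inverse is differentiated, so powers of
  the determinant enter the denominator.\<close>

lemma darboux_right_factor:
  assumes P: "\<And>n. P n \<in> carrier_mat N N"
    and diag: "\<And>n r c. r < N \<Longrightarrow> c < N \<Longrightarrow> r \<noteq> c \<Longrightarrow> P n $$ (r,c) = 0"
    and Q: "\<And>n. Q n \<in> carrier_mat N N" "monic_family N (\<lambda>n r c. Q n $$ (r,c))"
    and D: "\<forall>F\<in>set D. F \<in> carrier_mat N N" and F: "F \<in> carrier_mat N N" "Determinant.det F \<noteq> 0"
    and C: "\<And>n. C n \<in> carrier_mat N N"
    and eq: "\<And>n z. Determinant.det (peval F z) \<noteq> 0 \<Longrightarrow>
      C n * peval (P n) z = fun_op_apply N (\<lambda>w. peval (Q n) w * minv (peval F w)) D z"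
    and i: "i < N"
  shows "\<exists>Y. \<forall>r<N. finite_order (Y r) \<and>
    (\<forall>n. \<forall>k<N. (\<Sum>r<N. Y r (Q n $$ (k,r))) = smult (C n $$ (k,i)) (P n $$ (i,i)))"
proof -
  let ?d = "Determinant.det F" and ?m = "length D"
  \<comment> \<open>Term \<open>j\<close> has denominator \<open>?d ^ Suc j\<close>; the factor
    \<open>?d ^ (?m - 1 - j)\<close> brings all terms to the common denominator
    \<open>?d ^ ?m\<close>.\<close>
  define num where "num r p = (\<Sum>j<?m. \<Sum>s<N. quot_numer ?d j (p * adj_mat F $$ (r,s)) *
    (?d ^ (?m - 1 - j) * (D ! j) $$ (s,i)))" for r p
  have quot_lin: "linear_op (quot_numer ?d j)" for j
    using finite_order_linear[OF finite_order_quot_numer[OF finite_order_id]] .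
  have num_fin: "finite_order (num r)" for r
    unfolding num_def
    by (intro finite_order_sum finite_order_mult finite_order_quot_numer finite_order_id)
  have num_Q: "(\<Sum>r<N. num r (Q n $$ (k,r))) = ?d ^ ?m * smult (C n $$ (k,i)) (P n $$ (i,i))" if k: "k < N" for n k
  proof (rule poly_eq_off_roots[OF F(2)])
    fix z assume z: "poly ?d z \<noteq> 0"
    define q where "q s = (\<Sum>r<N. Q n $$ (k,r) * adj_mat F $$ (r,s))" for s
    have entry: "(\<lambda>w. (peval (Q n) w * minv (peval F w)) $$ (k,s)) = (\<lambda>w. poly (q s) w / poly ?d w)" if "s < N" for s
      using k that by (simp add: fun_eq_iff q_def mult_mat_entry[OF peval_carrier[OF Q(1)] minv_peval(1)[OF F(1)]]
          peval_entry[OF Q(1)] minv_peval(2)[OF F(1)] poly_sum sum_divide_distrib)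
    have summand: "(mderiv N j (\<lambda>w. peval (Q n) w * minv (peval F w)) z * peval (D ! j) z) $$ (k,i)
        = (\<Sum>s<N. poly (quot_numer ?d j (q s)) z / poly ?d z ^ Suc j * poly ((D ! j) $$ (s,i)) z)" if j: "j < ?m" for j
    proof -
      have Dj: "D ! j \<in> carrier_mat N N" using D j by auto
      have "(mderiv N j (\<lambda>w. peval (Q n) w * minv (peval F w)) z * peval (D ! j) z) $$ (k,i)
        = (\<Sum>s<N. mderiv N j (\<lambda>w. peval (Q n) w * minv (peval F w)) z $$ (k,s) * peval (D ! j) z $$ (s,i))"
        using k i Dj by (intro mult_mat_entry) (auto simp: mderiv_def peval_carrier)
      also have "\<dots> = (\<Sum>s<N. poly (quot_numer ?d j (q s)) z / poly ?d z ^ Suc j * poly ((D ! j) $$ (s,i)) z)"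
      proof (rule sum.cong[OF refl])
        fix s assume "s \<in> {..<N}"
        then have s: "s < N" by simp
        have "mderiv N j (\<lambda>w. peval (Q n) w * minv (peval F w)) z $$ (k,s)
            = (deriv ^^ j) (\<lambda>w. (peval (Q n) w * minv (peval F w)) $$ (k,s)) z"
          using k s by (simp add: mderiv_def)
        also have "\<dots> = poly (quot_numer ?d j (q s)) z / poly ?d z ^ Suc j"
          unfolding entry[OF s] by (rule higher_deriv_quotient[OF z])
        finally show "mderiv N j (\<lambda>w. peval (Q n) w * minv (peval F w)) z $$ (k,s) * peval (D ! j) z $$ (s,i)
          = poly (quot_numer ?d j (q s)) z / poly ?d z ^ Suc j * poly ((D ! j) $$ (s,i)) z"
          using peval_entry[OF Dj s i] by simp
      qed
      finally show ?thesis .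
    qed
    have "C n $$ (k,i) * poly (P n $$ (i,i)) z = (C n * peval (P n) z) $$ (k,i)"
    proof -
      have "(C n * peval (P n) z) $$ (k,i) = (\<Sum>l<N. C n $$ (k,l) * peval (P n) z $$ (l,i))"
        by (rule mult_mat_entry[OF C peval_carrier[OF P] k i])
      also have "\<dots> = (\<Sum>l<N. if l = i then C n $$ (k,i) * poly (P n $$ (i,i)) z else 0)"
        using i by (intro sum.cong) (auto simp: peval_entry[OF P] diag)
      finally show ?thesis using i by simp
    qed
    also have "\<dots> = (\<Sum>j<?m. \<Sum>s<N. poly (quot_numer ?d j (q s)) z / poly ?d z ^ Suc j * poly ((D ! j) $$ (s,i)) z)"
      using eq[of z n] z k i by (simp add: det_peval fun_op_apply_def summand)
    finally have "poly ?d z ^ ?m * (C n $$ (k,i) * poly (P n $$ (i,i)) z)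
        = (\<Sum>j<?m. \<Sum>s<N. poly ?d z ^ ?m * (poly (quot_numer ?d j (q s)) z / poly ?d z ^ Suc j * poly ((D ! j) $$ (s,i)) z))"
      by (simp only: sum_distrib_left)
    also have "\<dots> = (\<Sum>j<?m. \<Sum>s<N. poly (quot_numer ?d j (q s)) z * (poly ?d z ^ (?m - 1 - j) * poly ((D ! j) $$ (s,i)) z))"
    proof (intro sum.cong refl)
      fix j s assume "j \<in> {..<?m}"
      then have "?m = (?m - 1 - j) + Suc j" by simp
      then have "poly ?d z ^ ?m = poly ?d z ^ (?m - 1 - j) * poly ?d z ^ Suc j"
        by (metis power_add)
      then show "poly ?d z ^ ?m * (poly (quot_numer ?d j (q s)) z / poly ?d z ^ Suc j * poly ((D ! j) $$ (s,i)) z)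
        = poly (quot_numer ?d j (q s)) z * (poly ?d z ^ (?m - 1 - j) * poly ((D ! j) $$ (s,i)) z)"
        using z by simp
    qed
    also have "\<dots> = poly (\<Sum>r<N. num r (Q n $$ (k,r))) z"
    proof -
      have "(\<Sum>r<N. num r (Q n $$ (k,r))) = (\<Sum>j<?m. \<Sum>r<N. \<Sum>s<N. quot_numer ?d j (Q n $$ (k,r) * adj_mat F $$ (r,s)) *
          (?d ^ (?m - 1 - j) * (D ! j) $$ (s,i)))"
        unfolding num_def by (rule sum.swap)
      also have "\<dots> = (\<Sum>j<?m. \<Sum>s<N. \<Sum>r<N. quot_numer ?d j (Q n $$ (k,r) * adj_mat F $$ (r,s)) *
          (?d ^ (?m - 1 - j) * (D ! j) $$ (s,i)))"
        by (rule sum.cong[OF refl]) (rule sum.swap)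
      also have "\<dots> = (\<Sum>j<?m. \<Sum>s<N. quot_numer ?d j (q s) * (?d ^ (?m - 1 - j) * (D ! j) $$ (s,i)))"
        by (simp only: q_def linear_opD(5)[OF quot_lin] sum_distrib_right)
      finally show ?thesis by (simp add: poly_sum)
    qed
    finally show "poly (\<Sum>r<N. num r (Q n $$ (k,r))) z = poly (?d ^ ?m * smult (C n $$ (k,i)) (P n $$ (i,i))) z"
      by (simp add: mult.left_commute)
  qed
  have dvd: "?d ^ ?m dvd num r p" if "r < N" for r p
    using Q(2) finite_order_linear[OF num_fin]
  proof (rule monic_family_dvd[OF _ _ _ that])
    show "?d ^ ?m dvd (\<Sum>r<N. num r (Q n $$ (k,r)))" if "k < N" for n k
      unfolding num_Q[OF that] by (rule dvd_triv_left)
  qed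
  have d: "?d ^ ?m \<noteq> 0" using F(2) by simp
  show ?thesis
  proof (intro exI[of _ "\<lambda>r p. num r p div ?d ^ ?m"] allI impI conjI)
    fix r n k assume r: "r < N"
    show "finite_order (\<lambda>p. num r p div ?d ^ ?m)"
      by (rule finite_order_exact_div[OF num_fin dvd[OF r] d])
    assume k: "k < N"
    have "?d ^ ?m * (\<Sum>r<N. num r (Q n $$ (k,r)) div ?d ^ ?m) = (\<Sum>r<N. num r (Q n $$ (k,r)))"
      unfolding sum_distrib_left using dvd by (intro sum.cong) simp_all
    also have "\<dots> = ?d ^ ?m * smult (C n $$ (k,i)) (P n $$ (i,i))" by (rule num_Q[OF k])
    finally show "(\<Sum>r<N. num r (Q n $$ (k,r)) div ?d ^ ?m) = smult (C n $$ (k,i)) (P n $$ (i,i))"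
      using d by (simp only: mult_cancel_left) simp
  qed
qed

lemma det_zero_of_row:
  assumes "A \<in> carrier_mat N N" "i < N" "\<And>c. c < N \<Longrightarrow> A $$ (i,c) = 0"
  shows "Determinant.det A = 0"
proof -
  have "Determinant.det A = (\<Sum>j<N. A $$ (i,j) * cofactor A i j)"
    using assms by (intro laplace_expansion_row) auto
  then show ?thesis using assms(3) by simp
qed

text \<open>Common core of the three families, which differ only in how moments, positivity and
  incompatibility of the weights are verified.\<close>

lemma not_darboux_of_direct_sum:
  fixes N :: nat and a :: "nat \<Rightarrow> real" and w :: "nat \<Rightarrow> real \<Rightarrow> real"
  assumes N: "2 \<le> N" and a: "a 1 \<noteq> 0"
    and mom: "\<And>i. i \<in> {1..N} \<Longrightarrow> finite_moments S (w i)"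
    and pos: "\<And>i. i \<in> {1..N} \<Longrightarrow> positive_functional (weight_functional S (w i))"
    and incompat: "\<And>i j u v. i \<in> {1..N} \<Longrightarrow> j \<in> {1..N} \<Longrightarrow> i \<noteq> j \<Longrightarrow>
      (\<And>p. weight_functional S (w j) (u * p) = weight_functional S (w i) (v * p)) \<Longrightarrow> u = 0"
  shows "\<not> darboux_of_direct_sum N S (conj_diag N a w)"
proof
  assume "darboux_of_direct_sum N S (conj_diag N a w)"
  then obtain S' v where v: "\<forall>i<N. scalar_weight S' (v i)"
    and dar: "darboux N S' (direct_sum N v) S (conj_diag N a w)"
    unfolding darboux_of_direct_sum_def by blast
  obtain P Q where P: "monic_OPs N S' (direct_sum N v) P" and Q: "monic_OPs N S (conj_diag N a w) Q"
    and PQ: "\<exists>D Dt F Ft C Ct.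
        fourier_R N P D \<and> fourier_R N P Dt \<and>
        F \<in> carrier_mat N N \<and> Ft \<in> carrier_mat N N \<and>
        Determinant.det F \<noteq> 0 \<and> Determinant.det Ft \<noteq> 0 \<and>
        (\<forall>n. C n \<in> carrier_mat N N \<and> Ct n \<in> carrier_mat N N) \<and>
        finite {n. Determinant.det (C n) = 0} \<and> finite {n. Determinant.det (Ct n) = 0} \<and>
        (\<forall>n z. Determinant.det (peval F z) \<noteq> 0 \<longrightarrow>
            C n * peval (Q n) z = peval (op_apply N (P n) D) z * minv (peval F z)) \<and>
        (\<forall>n z. Determinant.det (peval Ft z) \<noteq> 0 \<longrightarrow>
            Ct n * peval (P n) z = fun_op_apply N (\<lambda>w. peval (Q n) w * minv (peval Ft w)) Dt z)"
    using dar unfolding darboux_def by blast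
  from PQ obtain D Dt F Ft C Ct where fR: "fourier_R N P D" "fourier_R N P Dt"
    and FFt: "F \<in> carrier_mat N N" "Ft \<in> carrier_mat N N" "Determinant.det F \<noteq> 0" "Determinant.det Ft \<noteq> 0"
    and CCt: "\<forall>n. C n \<in> carrier_mat N N \<and> Ct n \<in> carrier_mat N N"
    and fin: "finite {n. Determinant.det (C n) = 0}" "finite {n. Determinant.det (Ct n) = 0}"
    and eq0: "\<forall>n z. Determinant.det (peval F z) \<noteq> 0 \<longrightarrow>
      C n * peval (Q n) z = peval (op_apply N (P n) D) z * minv (peval F z)"
    and eqt0: "\<forall>n z. Determinant.det (peval Ft z) \<noteq> 0 \<longrightarrow>
      Ct n * peval (P n) z = fun_op_apply N (\<lambda>w. peval (Q n) w * minv (peval Ft w)) Dt z"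
    by (elim exE conjE) (rule that)
  note F = FFt(1,3) and Ft = FFt(2,4) and eq = eq0[rule_format] and eqt = eqt0[rule_format]
  have C: "C n \<in> carrier_mat N N" and Ct: "Ct n \<in> carrier_mat N N" for n using CCt by auto
  have D: "\<forall>F\<in>set D. F \<in> carrier_mat N N" "\<forall>F\<in>set Dt. F \<in> carrier_mat N N"
    using fR unfolding fourier_R_def by blast+
  note Pc = monic_OPs_family[OF P] and Qc = monic_OPs_family[OF Q]
  have diag: "P n $$ (r,c) = 0" if "r < N" "c < N" "r \<noteq> c" for n r c
    using direct_sum_OPs_diagonal[OF v P that] .

  define A where "A r c = matA N a $$ (r,c)" for r c
  have A_def': "A r c = (if c = r + 1 \<and> even r then a (r + 1) else if r = c + 1 \<and> odd c then a (c + 1) else 0)"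
    if "r < N" "c < N" for r c using that by (simp add: A_def matA_def)
  \<comment> \<open>A nonzero entry of \<open>A\<close> has even row and odd column, counted from 0,
    so \<open>A\<close> squares to zero and \<open>I - A x\<close> inverts \<open>T\<close>.\<close>
  have AA: "A r s * A s c = 0" if "r < N" "s < N" "c < N" for r s c
    using that by (auto simp: A_def')
  define \<delta> :: "nat \<Rightarrow> nat \<Rightarrow> complex poly" where "\<delta> r c = (if r = c then 1 else 0)" for r c
  define T where "T r c = \<delta> r c + [:0, complex_of_real (A r c):]" for r c
  define Ti where "Ti r c = \<delta> r c - [:0, complex_of_real (A r c):]" for r c
  define t where "t r c x = (if r = c then 1 else 0) + x * A r c" for r c :: nat and x :: real
  define X where "X r c = [:0, complex_of_real (A r c):]" for r c
  have XX: "X r s * X s c = 0" if "r < N" "s < N" "c < N" for r s c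
    using AA[OF that] by (auto simp: X_def)
  have \<delta>_sum: "(\<Sum>s<N. \<delta> r s * f s) = f r" "(\<Sum>s<N. f s * \<delta> s r) = f r" if "r < N" for r f
    using that sum_delta_mult[of r N f] by (simp_all add: \<delta>_def)
  have inverse: "(\<Sum>s<N. T r s * Ti s c) = (if r = c then 1 else 0)"
    "(\<Sum>s<N. Ti r s * T s c) = (if r = c then 1 else 0)" if rc: "r < N" "c < N" for r c
  proof -
    note expand = T_def[folded X_def] Ti_def[folded X_def] distrib_left distrib_right
      left_diff_distrib right_diff_distrib
    have "(\<Sum>s<N. T r s * Ti s c) = (\<Sum>s<N. \<delta> r s * \<delta> s c + X r s * \<delta> s c - \<delta> r s * X s c)"
      using rc by (intro sum.cong refl) (simp add: expand XX)
    also have "\<dots> = \<delta> r c"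
      using rc by (simp add: sum.distrib sum_subtractf \<delta>_sum)
    finally show "(\<Sum>s<N. T r s * Ti s c) = (if r = c then 1 else 0)" by (simp add: \<delta>_def)
    have "(\<Sum>s<N. Ti r s * T s c) = (\<Sum>s<N. \<delta> r s * \<delta> s c + \<delta> r s * X s c - X r s * \<delta> s c)"
      using rc by (intro sum.cong refl) (simp add: expand XX)
    also have "\<dots> = \<delta> r c"
      using rc by (simp add: sum.distrib sum_subtractf \<delta>_sum)
    finally show "(\<Sum>s<N. Ti r s * T s c) = (if r = c then 1 else 0)" by (simp add: \<delta>_def)
  qed
  have Tc: "matT N a x \<in> carrier_mat N N" "r < N \<Longrightarrow> c < N \<Longrightarrow> matT N a x $$ (r,c) = t r c x" for x r c
    by (auto simp: matT_def matA_def t_def A_def)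
  have deg: "deg_below 2 (\<delta> r c)" "deg_below 2 [:0, z:]" for r c and z :: complex
    by (auto simp: deg_below_def \<delta>_def coeff_pCons split: nat.splits)

  \<comment> \<open>Weights are indexed from 1 and rows from 0, hence
    \<open>w (Suc s)\<close>.\<close>
  interpret orthogonal_rows N "\<lambda>s. weight_functional S (w (Suc s))" T Ti "\<lambda>n r c. Q n $$ (r,c)"
  proof (rule orthogonal_rows_of_monic_OPs[OF Q, where t = t])
    let ?W = "\<lambda>x. mat N N (\<lambda>(i,j). if i = j then w (i + 1) x else 0)"
    show "conj_diag N a w x \<in> carrier_mat N N" for x
      unfolding conj_diag_def using Tc(1)
      by (intro mult_carrier_mat[of _ N N] transpose_carrier_mat[THEN iffD2]) simp_all
    show "conj_diag N a w x $$ (r,c) = (\<Sum>s<N. t r s x * w (Suc s) x * t c s x)" if "r < N" "c < N" for x r c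
    proof -
      have TW: "matT N a x * ?W x \<in> carrier_mat N N" using Tc(1) by (intro mult_carrier_mat[of _ N N]) simp_all
      have "(matT N a x * ?W x) $$ (r,s) = t r s x * w (Suc s) x" if "s < N" for s
      proof -
        have "(matT N a x * ?W x) $$ (r,s) = (\<Sum>k<N. matT N a x $$ (r,k) * ?W x $$ (k,s))"
          using \<open>r < N\<close> that Tc(1) by (intro mult_mat_entry) auto
        also have "\<dots> = (\<Sum>k<N. if k = s then t r s x * w (Suc s) x else 0)"
          using \<open>r < N\<close> that by (intro sum.cong) (auto simp: Tc(2))
        finally show ?thesis using that by simp
      qed
      moreover have "conj_diag N a w x $$ (r,c)
          = (\<Sum>s<N. (matT N a x * ?W x) $$ (r,s) * transpose_mat (matT N a x) $$ (s,c))"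
        unfolding conj_diag_def using that TW Tc(1) by (intro mult_mat_entry) auto
      ultimately show ?thesis using that Tc carrier_matD[OF Tc(1)[of x]] by simp
    qed
    show "poly (T r s) (complex_of_real x) = complex_of_real (t r s x)" for r s x
      by (simp add: T_def t_def \<delta>_def)
    show "deg_below 2 (T r c)" for r c unfolding T_def by (intro deg_below_add deg)
    show "deg_below 2 (Ti r c)" for r c
      unfolding Ti_def using deg(1)[of r c] deg(2)[of "complex_of_real (A r c)"]
      by (simp add: deg_below_def)
    show "map_poly cnj (T r c) = T r c" for r c
      by (simp add: T_def \<delta>_def map_poly_cnj_add map_poly_pCons)
  qed (auto simp: inverse intro!: mom pos)

  interpret orthogonal_rows_linear N "\<lambda>s. weight_functional S (w (Suc s))" T Ti "\<lambda>n r c. Q n $$ (r,c)"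
    "complex_of_real (a 1)"
  proof
    show "2 \<le> N" "complex_of_real (a 1) \<noteq> 0" using N a by auto
    show "T 0 c = (if c = 0 then 1 else if c = 1 then [:0, complex_of_real (a 1):] else 0)" if "c < N" for c
      using that N by (auto simp: T_def A_def' \<delta>_def)
    show "T 1 c = (if c = 1 then 1 else 0)" "Ti 1 c = (if c = 1 then 1 else 0)" if "c < N" for c
      using that N by (auto simp: T_def Ti_def A_def' \<delta>_def)
    show "Ti 0 0 = 1" "Ti 0 1 = [:0, - complex_of_real (a 1):]"
      using N by (auto simp: Ti_def A_def' \<delta>_def)
    show "u = 0" if "i < N" "j < N" "i \<noteq> j"
      "\<And>p. weight_functional S (w (Suc j)) (u * p) = weight_functional S (w (Suc i)) (v * p)" for i j u v
      using incompat[of "Suc i" "Suc j" u v] that by simp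
  qed

  \<comment> \<open>\<open>Y\<close> sends row k of \<open>Q n\<close> to the multiple
    \<open>Ct n $$ (k,i)\<close> of the scalar polynomial \<open>P n $$ (i,i)\<close>, and
    \<open>Z\<close> sends that polynomial to row \<open>i\<close> of \<open>C n * Q n\<close>. The
    eigenvalues are thus products, whose minors vanish by commutativity.\<close>
  have zero: "Ct n $$ (1,i) * C n $$ (i,c) = 0" if i: "i < N" and c: "c < N" for n i c
  proof -
    obtain Z where Z: "\<And>c. c < N \<Longrightarrow> finite_order (Z c)"
      "\<And>c n. c < N \<Longrightarrow> Z c (P n $$ (i,i)) = (\<Sum>k<N. smult (C n $$ (i,k)) (Q n $$ (k,c)))"
      using darboux_left_factor[OF Pc diag Qc(1) D(1) F C eq i] by blast
    obtain Y where Y: "\<And>r. r < N \<Longrightarrow> finite_order (Y r)"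
      "\<And>n k. k < N \<Longrightarrow> (\<Sum>r<N. Y r (Q n $$ (k,r))) = smult (Ct n $$ (k,i)) (P n $$ (i,i))"
      using darboux_right_factor[OF Pc(1) diag Qc D(2) Ft Ct eqt i] i by blast
    show ?thesis
    proof (rule eigenvalue_row_zero[where X = "\<lambda>r c p. Z c (Y r p)"
          and \<Lambda> = "\<lambda>n k l. Ct n $$ (k,i) * C n $$ (i,l)"])
      show "finite_order (\<lambda>p. Z c (Y r p))" if "r < N" "c < N" for r c
        by (rule finite_order_comp[OF Z(1)[OF that(2)] Y(1)[OF that(1)]])
      show "(\<Sum>r<N. Z c (Y r (Q n $$ (k,r)))) = (\<Sum>l<N. smult (Ct n $$ (k,i) * C n $$ (i,l)) (Q n $$ (l,c)))"
        if "k < N" "c < N" for n k c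
      proof -
        note Zlin = linear_opD[OF finite_order_linear[OF Z(1)[OF that(2)]]]
        have "(\<Sum>r<N. Z c (Y r (Q n $$ (k,r)))) = Z c (\<Sum>r<N. Y r (Q n $$ (k,r)))"
          by (simp only: Zlin(5))
        also have "\<dots> = smult (Ct n $$ (k,i)) (\<Sum>l<N. smult (C n $$ (i,l)) (Q n $$ (l,c)))"
          unfolding Y(2)[OF that(1)] Zlin(2) Z(2)[OF that(2)] ..
        finally show ?thesis by (simp add: smult_sum_right)
      qed
    qed (use c in auto)
  qed
  obtain n where n: "Determinant.det (C n) \<noteq> 0" "Determinant.det (Ct n) \<noteq> 0"
  proof -
    have "finite ({n. Determinant.det (C n) = 0} \<union> {n. Determinant.det (Ct n) = 0})" using fin by simp
    then show ?thesis using that ex_new_if_finite[OF infinite_UNIV_nat] by blast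
  qed
  \<comment> \<open>Row 1 of the nonsingular \<open>Ct n\<close> has a nonzero entry, in column
    \<open>i\<close> say; \<open>zero\<close> then empties row \<open>i\<close> of
    \<open>C n\<close>.\<close>
  obtain i where i: "i < N" "Ct n $$ (1,i) \<noteq> 0"
    using det_zero_of_row[OF Ct, of 1 n] n(2) N by auto
  then have "C n $$ (i,c) = 0" if "c < N" for c using zero[OF i(1) that, of n] by simp
  then show False using det_zero_of_row[OF C i(1)] n(1) by blast
qed

theorem theorem3p11:
  fixes N :: nat and a b \<alpha>L \<alpha>J \<beta>J :: "nat \<Rightarrow> real"
  assumes "N \<ge> 2"
    and "\<forall>j\<in>{1..<N}. a j \<noteq> 0"
  shows "((\<forall>i\<in>{1..N}. \<forall>j\<in>{1..N}. i \<noteq> j \<longrightarrow> b i \<noteq> b j) \<longrightarrow>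
            \<not> darboux_of_direct_sum N UNIV (W_H N a b))
       \<and> ((\<forall>i\<in>{1..N}. \<alpha>L i > -1) \<and>
          (\<forall>i\<in>{1..N}. \<forall>j\<in>{1..N}. i \<noteq> j \<longrightarrow> \<alpha>L i - \<alpha>L j \<notin> \<int>) \<longrightarrow>
            \<not> darboux_of_direct_sum N {0<..} (W_L N a \<alpha>L))
       \<and> ((\<forall>i\<in>{1..N}. \<alpha>J i > -1 \<and> \<beta>J i > -1) \<and>
          (\<forall>i\<in>{1..N}. \<forall>j\<in>{1..N}. i \<noteq> j \<longrightarrow> \<alpha>J i - \<alpha>J j \<notin> \<int> \<or> \<beta>J i - \<beta>J j \<notin> \<int>) \<and>
          (\<forall>j\<in>{1..N}. \<alpha>J 1 + \<beta>J 1 = \<alpha>J j + \<beta>J j + 1 + (-1) ^ j) \<longrightarrow>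
            \<not> darboux_of_direct_sum N {-1<..<1} (W_J N a \<alpha>J \<beta>J))"
proof (intro conjI impI)
  have a1: "a 1 \<noteq> 0" using assms by simp
  assume b: "\<forall>i\<in>{1..N}. \<forall>j\<in>{1..N}. i \<noteq> j \<longrightarrow> b i \<noteq> b j"
  show "\<not> darboux_of_direct_sum N UNIV (W_H N a b)"
    unfolding W_H_def
  proof (rule not_darboux_of_direct_sum[where a = a, OF assms(1) a1])
    fix i j u v assume ij: "i \<in> {1..N}" "j \<in> {1..N}" "i \<noteq> j"
      and eq: "\<And>p. weight_functional UNIV (hermite_w (b j)) (u * p) = weight_functional UNIV (hermite_w (b i)) (v * p)"
    show "u = 0" by (rule hermite_incompatible[of b i j, OF _ eq]) (use b ij in blast)
  qed (rule finite_moments_hermite positive_hermite)+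
next
  have a1: "a 1 \<noteq> 0" using assms by simp
  assume "(\<forall>i\<in>{1..N}. \<alpha>L i > -1) \<and>
    (\<forall>i\<in>{1..N}. \<forall>j\<in>{1..N}. i \<noteq> j \<longrightarrow> \<alpha>L i - \<alpha>L j \<notin> \<int>)"
  then have al: "\<And>i. i \<in> {1..N} \<Longrightarrow> \<alpha>L i > -1"
    and nonint: "\<And>i j. i \<in> {1..N} \<Longrightarrow> j \<in> {1..N} \<Longrightarrow> i \<noteq> j \<Longrightarrow> \<alpha>L i - \<alpha>L j \<notin> \<int>" by blast+
  show "\<not> darboux_of_direct_sum N {0<..} (W_L N a \<alpha>L)"
    unfolding W_L_def
  proof (rule not_darboux_of_direct_sum[where a = a, OF assms(1) a1])
    fix i j u v assume ij: "i \<in> {1..N}" "j \<in> {1..N}" "i \<noteq> j"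
      and eq: "\<And>p. weight_functional {0<..} (laguerre_w (\<alpha>L j)) (u * p) = weight_functional {0<..} (laguerre_w (\<alpha>L i)) (v * p)"
    show "u = 0"
      by (rule laguerre_incompatible[of \<alpha>L i j, OF al[OF ij(1)] al[OF ij(2)] nonint[OF ij(2,1)] eq])
        (use ij in blast)
  qed (use al finite_moments_laguerre positive_laguerre in blast)+
next
  have a1: "a 1 \<noteq> 0" using assms by simp
  assume "(\<forall>i\<in>{1..N}. \<alpha>J i > -1 \<and> \<beta>J i > -1) \<and>
    (\<forall>i\<in>{1..N}. \<forall>j\<in>{1..N}. i \<noteq> j \<longrightarrow> \<alpha>J i - \<alpha>J j \<notin> \<int> \<or> \<beta>J i - \<beta>J j \<notin> \<int>) \<and>
    (\<forall>j\<in>{1..N}. \<alpha>J 1 + \<beta>J 1 = \<alpha>J j + \<beta>J j + 1 + (-1) ^ j)"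
  then have al: "\<And>i. i \<in> {1..N} \<Longrightarrow> \<alpha>J i > -1" and be: "\<And>i. i \<in> {1..N} \<Longrightarrow> \<beta>J i > -1"
    and nonint: "\<And>i j. i \<in> {1..N} \<Longrightarrow> j \<in> {1..N} \<Longrightarrow> i \<noteq> j \<Longrightarrow> \<alpha>J i - \<alpha>J j \<notin> \<int> \<or> \<beta>J i - \<beta>J j \<notin> \<int>"
    by blast+
  show "\<not> darboux_of_direct_sum N {-1<..<1} (W_J N a \<alpha>J \<beta>J)"
    unfolding W_J_def
  proof (rule not_darboux_of_direct_sum[where a = a, OF assms(1) a1])
    fix i j u v assume ij: "i \<in> {1..N}" "j \<in> {1..N}" "i \<noteq> j"
      and eq: "\<And>p. weight_functional {-1<..<1} (jacobi_w (\<alpha>J j) (\<beta>J j)) (u * p)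
        = weight_functional {-1<..<1} (jacobi_w (\<alpha>J i) (\<beta>J i)) (v * p)"
    show "u = 0"
      by (rule jacobi_incompatible[of \<alpha>J i \<beta>J j, OF al[OF ij(1)] be[OF ij(1)] al[OF ij(2)] be[OF ij(2)]
            nonint[OF ij(2,1)] eq]) (use ij in blast)
  qed (use al be finite_moments_jacobi positive_jacobi in blast)+
qed

end
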